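(* Let $p\ge1$ and $\mu\ge p+1$ be integers. Given periodic or compactly supported boundary conditions and an affine mesh $\mathcal T_h$ of $\Omega\subset\mathbb{R}^2$, let $\widetilde u$ be given by the entropy-stable Line-DG semi-discretization $\partial_t\widetilde u_{ij}+\widehat q_{ij}+\widehat r_{ij}=0$ of the context (assumed differentiable in time), and let $u_K=\widetilde u_K/g_K$ be the corresponding conservative variables on the element $K$. Then $$\frac{d}{dt}\sum_{K\in\mathcal T_h}\sum_{\alpha,\beta=1}^{\mu}w_\alpha w_\beta\,g_K\,U\bigl(u_K(y_\alpha,y_\beta,t)\bigr)\le0.$$
   Context: Conservation law and entropy. The system is $\partial_tu+\nabla\cdot f(u)=0$, with $u$ valued in $\mathbb{R}^{n_c}$ and $f=(f_1,f_2)$, $f_j:\mathbb{R}^{n_c}\to\mathbb{R}^{n_c}$. $U$ is a uniformly convex entropy function with entropy fluxes $F_j$, i.e. $U'(u)f_j'(u)=F_j'(u)$. The entropy variables are $v=U'(u)$; the map $u\mapsto v$ is invertible with inverse $u(v)$, and all states considered lie in the domain where these maps are defined. The flux potentials are $\psi_j=f_j(u)^Tv-F_j(u)$. Numerical fluxes. $f_{j,S}(u_L,u_R)$, $j=1,2$, are entropy-conservative two-point fluxes: $f_{j,S}(u,u)=f_j(u)$, $f_{j,S}(u_L,u_R)=f_{j,S}(u_R,u_L)$, and $(v_R-v_L)^Tf_{j,S}(u_L,u_R)=\psi_{j,R}-\psi_{j,L}$. $\widehat f(u_L,u_R;n)$ is an entropy-stable normal interface flux, $n$ pointing from side $L$ to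 side $R$: $\widehat f(u,u;n)=\sum_j n_jf_j(u)$, $\widehat f(u_L,u_R;n)=-\widehat f(u_R,u_L;-n)$ (single-valuedness), and $(v_R-v_L)^T\widehat f(u_L,u_R;n)\le\sum_jn_j(\psi_{j,R}-\psi_{j,L})$. Mesh. $\Omega$ is partitioned into a conforming mesh $\mathcal T_h$ of elements $K=T_K([0,1]^2)$ with $T_K$ affine; $x=T_K(\xi,\eta)$, $J=(\partial x_i/\partial\xi_j)$ and $g=g_K=\det J>0$ are constant on each $K$. Boundary conditions are periodic (boundary edges are identified in pairs), or compactly supported, meaning the total contribution of edges on $\partial\Omega$ vanishes. One-dimensional operators. $\xi_0<\dots<\xi_p$ and $\omega_0,\dots,\omega_p$ are the $(p+1)$-point Gauss-Lobatto nodes and weights on $[0,1]$, with Lagrange polynomials $\phi_i$ of degree $p$; $y_1<\dots<y_\mu$, $w_1,\dots,w_\mu$ are the points and weights of the $\mu$-point Gauss-Lobatto quadrature on $[0,1]$, with Lagrange polynomials $\widetilde\phi_\beta$ of degree $\mu-1$. $G_{\alpha i}=\phi_i(y_\alpha)$, $\widetilde D_{\alpha\beta}=\widetilde\phi_\beta'(y_\alpha)$, $W=\mathrm{diag}(w_\alpha)$, $M=G^TWG$, $\widetilde M=\mathrm{diag}(\omega_0,\dots,\omega_p)$. Unknowns and entropy projection. On each element the unknown is $\widetilde u(\xi,\eta,t)=\sum_{i,j=0}^p\widetilde u_{ij}(t)\phi_i(\xi)\phi_j(\eta)$, representing $g\,u(T_K(\xi,\eta),t)$. Put $\widetilde v=U'(\widetilde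 u/g)$. Let $\widehat v$ be the unique (vector-valued) polynomial of degree $\le p$ in each variable with $\sum_{\alpha,\beta}w_\alpha w_\beta\,\widehat v(y_\alpha,y_\beta)\cdot\phi(y_\alpha,y_\beta)=\sum_{\alpha,\beta}w_\alpha w_\beta\,\widetilde v(y_\alpha,y_\beta)\cdot\phi(y_\alpha,y_\beta)$ for all such polynomials $\phi$, and set $\widehat u=u(\widehat v)$. Transformed fluxes. $\widetilde f_{i,S}=g\sum_{j=1}^2(J^{-1})_{ij}f_{j,S}$ and $\widetilde f_i=g\sum_{j=1}^2(J^{-1})_{ij}f_j$. Scheme. For fixed $j$, $q_{:j}=(q_{ij})_{i=0}^p$ is defined by $(Mq_{:j})_i=2\sum_{\alpha,\beta=1}^\mu\phi_i(y_\alpha)w_\alpha\widetilde D_{\alpha\beta}\,\widetilde f_{1,S}\bigl(\widehat u(y_\alpha,\xi_j),\widehat u(y_\beta,\xi_j)\bigr)-\Bigl[\phi_i\,\widetilde f_1(\widehat u(\cdot,\xi_j))\Bigr]_{0}^{1}+\phi_i(1)\widehat f(\widehat u^-,\widehat u^+;n)\big|_{(1,\xi_j)}+\phi_i(0)\widehat f(\widehat u^-,\widehat u^+;n)\big|_{(0,\xi_j)}$, where $\widehat u^-$ and $\widehat u^+$ are the traces of $\widehat u$ from inside $K$ and from the neighboring element, and $n=gJ^{-T}N$ with $N$ the outward unit normal of the reference square ($N=(1,0)$ at $\xi=1$, $N=(-1,0)$ at $\xi=0$). For fixed $i$, $r_{i:}=(r_{ij})_{j=0}^p$ is defined by the same formula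 along the line $\xi=\xi_i$ in the $\eta$ direction, with $\widetilde f_{2,S},\widetilde f_2$, points $(\xi_i,y_\alpha)$ in place of $(y_\alpha,\xi_j)$, and $N=(0,\pm1)$. The quadrature-projected variants are $\widehat q_{ij}=\sum_{k=0}^p(M^{-1}\widetilde M)_{jk}\,q_{ik}$ and $\widehat r_{ij}=\sum_{k=0}^p(M^{-1}\widetilde M)_{ik}\,r_{kj}$. The scheme is $\partial_t\widetilde u_{ij}+\widehat q_{ij}+\widehat r_{ij}=0$ on every element. *)

theory Defs
  imports "HOL-Analysis.Analysis" "HOL-Computational_Algebra.Polynomial"
begin

section \<open>Entropy and numerical fluxes\<close>

text \<open>\<open>D\<close> is the set of admissible states, \<open>v = U'\<close> are the entropy variables and
  \<open>f j\<close>, \<open>F j\<close> the fluxes and entropy fluxes in direction \<open>j\<close>. Uniform convexity is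
  \<open>U'' \<ge> c > 0\<close>, written without second derivatives.\<close>

definition entropy_system ::
  "(real^'c) set \<Rightarrow> (real^'c \<Rightarrow> real) \<Rightarrow> (real^'c \<Rightarrow> real^'c) \<Rightarrow>
   (2 \<Rightarrow> real^'c \<Rightarrow> real^'c) \<Rightarrow> (2 \<Rightarrow> real^'c \<Rightarrow> real) \<Rightarrow> bool" where
  "entropy_system D U v f F \<longleftrightarrow>
     open D \<and>
     (\<exists>c>0. convex_on D (\<lambda>u. U u - c / 2 * (norm u)\<^sup>2)) \<and>
     (\<forall>u\<in>D. GDERIV U u :> v u) \<and>
     inj_on v D \<and>
     (\<forall>j. \<forall>u\<in>D. \<exists>f'. (f j has_derivative f') (at u) \<and>
                     (F j has_derivative (\<lambda>h. v u \<bullet> f' h)) (at u))"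

definition flux_potential ::
  "(real^'c \<Rightarrow> real^'c) \<Rightarrow> (2 \<Rightarrow> real^'c \<Rightarrow> real^'c) \<Rightarrow> (2 \<Rightarrow> real^'c \<Rightarrow> real) \<Rightarrow>
   2 \<Rightarrow> real^'c \<Rightarrow> real" where
  "flux_potential v f F j u = f j u \<bullet> v u - F j u"

definition entropy_conservative_flux ::
  "(real^'c) set \<Rightarrow> (real^'c \<Rightarrow> real^'c) \<Rightarrow> (2 \<Rightarrow> real^'c \<Rightarrow> real^'c) \<Rightarrow>
   (2 \<Rightarrow> real^'c \<Rightarrow> real) \<Rightarrow> (2 \<Rightarrow> real^'c \<Rightarrow> real^'c \<Rightarrow> real^'c) \<Rightarrow> bool" where
  "entropy_conservative_flux D v f F fS \<longleftrightarrow>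
     (\<forall>j. \<forall>u\<in>D. fS j u u = f j u) \<and>
     (\<forall>j. \<forall>uL\<in>D. \<forall>uR\<in>D. fS j uL uR = fS j uR uL) \<and>
     (\<forall>j. \<forall>uL\<in>D. \<forall>uR\<in>D.
        (v uR - v uL) \<bullet> fS j uL uR = flux_potential v f F j uR - flux_potential v f F j uL)"

text \<open>The normal argument is not normalised.\<close>

definition entropy_stable_flux ::
  "(real^'c) set \<Rightarrow> (real^'c \<Rightarrow> real^'c) \<Rightarrow> (2 \<Rightarrow> real^'c \<Rightarrow> real^'c) \<Rightarrow>
   (2 \<Rightarrow> real^'c \<Rightarrow> real) \<Rightarrow> (real^'c \<Rightarrow> real^'c \<Rightarrow> real^2 \<Rightarrow> real^'c) \<Rightarrow> bool" where
  "entropy_stable_flux D v f F fhat \<longleftrightarrow>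
     (\<forall>n. n \<noteq> 0 \<longrightarrow> (\<forall>u\<in>D. fhat u u n = (\<Sum>j\<in>UNIV. n $ j *\<^sub>R f j u))) \<and>
     (\<forall>n. n \<noteq> 0 \<longrightarrow> (\<forall>uL\<in>D. \<forall>uR\<in>D. fhat uL uR n = - fhat uR uL (- n))) \<and>
     (\<forall>n. n \<noteq> 0 \<longrightarrow> (\<forall>uL\<in>D. \<forall>uR\<in>D.
        (v uR - v uL) \<bullet> fhat uL uR n
          \<le> (\<Sum>j\<in>UNIV. n $ j * (flux_potential v f F j uR - flux_potential v f F j uL))))"

section \<open>One-dimensional operators\<close>

text \<open>The \<open>n\<close>-point Gauss-Lobatto rule on \<open>[0,1]\<close>, with nodes and weights numbered from 0:
  both end points are nodes and the rule has the optimal degree of exactness \<open>2n - 3\<close>.\<close>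

definition gauss_lobatto :: "nat \<Rightarrow> (nat \<Rightarrow> real) \<Rightarrow> (nat \<Rightarrow> real) \<Rightarrow> bool" where
  "gauss_lobatto n x c \<longleftrightarrow>
     2 \<le> n \<and> strict_mono_on {..<n} x \<and> x 0 = 0 \<and> x (n - 1) = 1 \<and>
     (\<forall>P :: real poly. degree P \<le> 2 * n - 3 \<longrightarrow>
        (\<Sum>i<n. c i * poly P (x i)) = integral {0..1} (poly P))"

definition lagrange_poly :: "nat \<Rightarrow> (nat \<Rightarrow> real) \<Rightarrow> nat \<Rightarrow> real poly" where
  "lagrange_poly n x i = (\<Prod>j\<in>{..<n} - {i}. smult (1 / (x i - x j)) [:- x j, 1:])"

definition diff_matrix :: "nat \<Rightarrow> (nat \<Rightarrow> real) \<Rightarrow> nat \<Rightarrow> nat \<Rightarrow> real" where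
  "diff_matrix \<mu> y \<alpha> \<beta> = poly (pderiv (lagrange_poly \<mu> y \<beta>)) (y \<alpha>)"

definition interp_matrix :: "nat \<Rightarrow> (nat \<Rightarrow> real) \<Rightarrow> (nat \<Rightarrow> real) \<Rightarrow> nat \<Rightarrow> nat \<Rightarrow> real" where
  "interp_matrix p \<xi> y \<alpha> i = poly (lagrange_poly (p + 1) \<xi> i) (y \<alpha>)"

definition mass_matrix ::
  "nat \<Rightarrow> nat \<Rightarrow> (nat \<Rightarrow> real) \<Rightarrow> (nat \<Rightarrow> real) \<Rightarrow> (nat \<Rightarrow> real) \<Rightarrow> nat \<Rightarrow> nat \<Rightarrow> real" where
  "mass_matrix p \<mu> \<xi> y w i k =
     (\<Sum>\<alpha><\<mu>. interp_matrix p \<xi> y \<alpha> i * w \<alpha> * interp_matrix p \<xi> y \<alpha> k)"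

text \<open>Inverse of the \<open>n \<times> n\<close> matrix \<open>(A i j)\<close> with \<open>i, j < n\<close>; only the entries with indices
  below \<open>n\<close> are meaningful (cf. \<open>matrix_inv\<close>).\<close>

definition nat_matrix_inv :: "nat \<Rightarrow> (nat \<Rightarrow> nat \<Rightarrow> real) \<Rightarrow> nat \<Rightarrow> nat \<Rightarrow> real" where
  "nat_matrix_inv n A = (SOME B. \<forall>i<n. \<forall>j<n.
     (\<Sum>k<n. A i k * B k j) = (if i = j then 1 else 0) \<and>
     (\<Sum>k<n. B i k * A k j) = (if i = j then 1 else 0))"

section \<open>Affine quadrilateral meshes\<close>

text \<open>An element is given by its affine map \<open>\<xi> \<mapsto> J \<xi> + b\<close>, i.e. by the pair \<open>(J, b)\<close>.\<close>

type_synonym elem = "(real^2^2) \<times> (real^2)"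

definition elem_map :: "elem \<Rightarrow> real^2 \<Rightarrow> real^2" where
  "elem_map K x = fst K *v x + snd K"

abbreviation jac :: "elem \<Rightarrow> real^2^2" where "jac K \<equiv> fst K"

abbreviation jdet :: "elem \<Rightarrow> real" where "jdet K \<equiv> det (jac K)"

definition elem_set :: "elem \<Rightarrow> (real^2) set" where
  "elem_set K = elem_map K ` cbox 0 1"

text \<open>A local edge is a triple \<open>(K, d, s)\<close> with \<open>s \<in> {0,1}\<close>: the image under the element map
  of the side \<open>{\<xi>. \<xi> $ d = s}\<close> of the reference square.\<close>

type_synonym elem_edge = "elem \<times> 2 \<times> real"

definition ref_edge :: "2 \<Rightarrow> real \<Rightarrow> (real^2) set" where
  "ref_edge d s = {x \<in> cbox 0 1. x $ d = s}"

definition edge_set :: "elem_edge \<Rightarrow> (real^2) set" where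
  "edge_set = (\<lambda>(K, d, s). elem_map K ` ref_edge d s)"

definition elem_edges :: "elem set \<Rightarrow> elem_edge set" where
  "elem_edges \<T> = \<T> \<times> UNIV \<times> {0, 1}"

definition elem_vertices :: "elem \<Rightarrow> (real^2) set" where
  "elem_vertices K = elem_map K ` {x. \<forall>i. x $ i \<in> {0, 1}}"

definition ref_normal :: "2 \<Rightarrow> real \<Rightarrow> real^2" where
  "ref_normal d s = (if s = 1 then axis d 1 else - axis d 1)"

definition edge_normal :: "elem_edge \<Rightarrow> real^2" where
  "edge_normal = (\<lambda>(K, d, s). jdet K *\<^sub>R (transpose (matrix_inv (jac K)) *v ref_normal d s))"

definition conforming_mesh :: "(real^2) set \<Rightarrow> elem set \<Rightarrow> bool" where
  "conforming_mesh \<Omega> \<T> \<longleftrightarrow>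
     finite \<T> \<and>
     (\<forall>K\<in>\<T>. jdet K > 0) \<and>
     \<Omega> = (\<Union>K\<in>\<T>. elem_set K) \<and>
     (\<forall>K\<in>\<T>. \<forall>K'\<in>\<T>. K \<noteq> K' \<longrightarrow>
        interior (elem_set K) \<inter> interior (elem_set K') = {} \<and>
        (elem_set K \<inter> elem_set K' = {} \<or>
         (\<exists>x \<in> elem_vertices K \<inter> elem_vertices K'. elem_set K \<inter> elem_set K' = {x}) \<or>
         (\<exists>e \<in> elem_edges {K}. \<exists>e' \<in> elem_edges {K'}.
            elem_set K \<inter> elem_set K' = edge_set e \<and> edge_set e = edge_set e')))"

definition boundary_edges :: "(real^2) set \<Rightarrow> elem set \<Rightarrow> elem_edge set" where
  "boundary_edges \<Omega> \<T> = {e \<in> elem_edges \<T>. edge_set e \<subseteq> frontier \<Omega>}"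

text \<open>Pairwise identification of the boundary edges by translations: the edge \<open>e\<close> is glued to
  \<open>per e\<close> by \<open>x \<mapsto> x + \<tau> e\<close>. The translated element lies on the other side of the common edge.\<close>

definition periodic_identification ::
  "(real^2) set \<Rightarrow> elem set \<Rightarrow> (elem_edge \<Rightarrow> elem_edge) \<Rightarrow> (elem_edge \<Rightarrow> real^2) \<Rightarrow> bool" where
  "periodic_identification \<Omega> \<T> per \<tau> \<longleftrightarrow>
     (\<forall>e \<in> boundary_edges \<Omega> \<T>.
        per e \<in> boundary_edges \<Omega> \<T> \<and> per e \<noteq> e \<and> per (per e) = e \<and> \<tau> (per e) = - \<tau> e \<and>
        (\<lambda>x. x + \<tau> e) ` edge_set e = edge_set (per e) \<and>
        interior ((\<lambda>x. x + \<tau> e) ` elem_set (fst e)) \<inter> interior (elem_set (fst (per e))) = {})"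

text \<open>A field on the mesh is given on each element in reference coordinates; \<open>up e x\<close> is its
  exterior trace at the reference point \<open>x\<close> of the edge \<open>e\<close>.\<close>

definition neighbor_traces ::
  "elem set \<Rightarrow> (elem \<Rightarrow> real^2 \<Rightarrow> 'a) \<Rightarrow> (elem_edge \<Rightarrow> real^2 \<Rightarrow> 'a) \<Rightarrow> bool" where
  "neighbor_traces \<T> uh up \<longleftrightarrow>
     (\<forall>(K, d, s) \<in> elem_edges \<T>. \<forall>(K', d', s') \<in> elem_edges \<T>.
        K \<noteq> K' \<and> edge_set (K, d, s) = edge_set (K', d', s') \<longrightarrow>
        (\<forall>x \<in> ref_edge d s. \<forall>x' \<in> ref_edge d' s'.
           elem_map K x = elem_map K' x' \<longrightarrow> up (K, d, s) x = uh K' x'))"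

definition periodic_traces ::
  "(real^2) set \<Rightarrow> elem set \<Rightarrow> (elem_edge \<Rightarrow> elem_edge) \<Rightarrow> (elem_edge \<Rightarrow> real^2) \<Rightarrow>
   (elem \<Rightarrow> real^2 \<Rightarrow> 'a) \<Rightarrow> (elem_edge \<Rightarrow> real^2 \<Rightarrow> 'a) \<Rightarrow> bool" where
  "periodic_traces \<Omega> \<T> per \<tau> uh up \<longleftrightarrow>
     (\<forall>(K, d, s) \<in> boundary_edges \<Omega> \<T>. \<forall>K' d' s'. per (K, d, s) = (K', d', s') \<longrightarrow>
        (\<forall>x \<in> ref_edge d s. \<forall>x' \<in> ref_edge d' s'.
           elem_map K x + \<tau> (K, d, s) = elem_map K' x' \<longrightarrow> up (K, d, s) x = uh K' x'))"

section \<open>The Line-DG scheme\<close>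

definition nodal_poly ::
  "nat \<Rightarrow> (nat \<Rightarrow> real) \<Rightarrow> (nat \<Rightarrow> nat \<Rightarrow> real^'c) \<Rightarrow> real^2 \<Rightarrow> real^'c" where
  "nodal_poly p \<xi> a x =
     (\<Sum>i\<le>p. \<Sum>j\<le>p. (poly (lagrange_poly (p + 1) \<xi> i) (x $ 1) *
                     poly (lagrange_poly (p + 1) \<xi> j) (x $ 2)) *\<^sub>R a i j)"

definition tensor_polys :: "nat \<Rightarrow> (real^2 \<Rightarrow> real^'c) set" where
  "tensor_polys p = {h. \<exists>a. \<forall>x. h x = (\<Sum>k\<le>p. \<Sum>l\<le>p. (x $ 1 ^ k * x $ 2 ^ l) *\<^sub>R a k l)}"

definition is_quadrature_projection ::
  "nat \<Rightarrow> nat \<Rightarrow> (nat \<Rightarrow> real) \<Rightarrow> (nat \<Rightarrow> real) \<Rightarrow>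
   (real^2 \<Rightarrow> real^'c) \<Rightarrow> (real^2 \<Rightarrow> real^'c) \<Rightarrow> bool" where
  "is_quadrature_projection p \<mu> y w vt vh \<longleftrightarrow>
     vh \<in> tensor_polys p \<and>
     (\<forall>h \<in> tensor_polys p.
        (\<Sum>\<alpha><\<mu>. \<Sum>\<beta><\<mu>. w \<alpha> * w \<beta> * (vh (vector [y \<alpha>, y \<beta>]) \<bullet> h (vector [y \<alpha>, y \<beta>]))) =
        (\<Sum>\<alpha><\<mu>. \<Sum>\<beta><\<mu>. w \<alpha> * w \<beta> * (vt (vector [y \<alpha>, y \<beta>]) \<bullet> h (vector [y \<alpha>, y \<beta>]))))"

definition transformed_flux ::
  "(2 \<Rightarrow> real^'c \<Rightarrow> real^'c) \<Rightarrow> elem \<Rightarrow> 2 \<Rightarrow> real^'c \<Rightarrow> real^'c" where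
  "transformed_flux f K d u = jdet K *\<^sub>R (\<Sum>j\<in>UNIV. matrix_inv (jac K) $ d $ j *\<^sub>R f j u)"

definition transformed_flux2 ::
  "(2 \<Rightarrow> real^'c \<Rightarrow> real^'c \<Rightarrow> real^'c) \<Rightarrow> elem \<Rightarrow> 2 \<Rightarrow> real^'c \<Rightarrow> real^'c \<Rightarrow> real^'c" where
  "transformed_flux2 fS K d uL uR =
     jdet K *\<^sub>R (\<Sum>j\<in>UNIV. matrix_inv (jac K) $ d $ j *\<^sub>R fS j uL uR)"

text \<open>The point with \<open>d\<close>-th coordinate \<open>a\<close> and other coordinate \<open>b\<close>.\<close>

definition line_pt :: "2 \<Rightarrow> real \<Rightarrow> real \<Rightarrow> real^2" where
  "line_pt d a b = (\<chi> i. if i = d then a else b)"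

text \<open>Right-hand side on the line of direction \<open>d\<close> through the transverse node \<open>\<xi> j\<close>, tested with
  the \<open>i\<close>-th Lagrange polynomial along the line; \<open>uh\<close> is the projected state on the element \<open>K\<close>.\<close>

definition line_rhs ::
  "nat \<Rightarrow> nat \<Rightarrow> (nat \<Rightarrow> real) \<Rightarrow> (nat \<Rightarrow> real) \<Rightarrow> (nat \<Rightarrow> real) \<Rightarrow>
   (2 \<Rightarrow> real^'c \<Rightarrow> real^'c) \<Rightarrow> (2 \<Rightarrow> real^'c \<Rightarrow> real^'c \<Rightarrow> real^'c) \<Rightarrow>
   (real^'c \<Rightarrow> real^'c \<Rightarrow> real^2 \<Rightarrow> real^'c) \<Rightarrow> elem \<Rightarrow>
   (real^2 \<Rightarrow> real^'c) \<Rightarrow> (elem_edge \<Rightarrow> real^2 \<Rightarrow> real^'c) \<Rightarrow> 2 \<Rightarrow> nat \<Rightarrow> nat \<Rightarrow> real^'c" where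
  "line_rhs p \<mu> \<xi> y w f fS fhat K uh up d i j =
    (let \<phi> = poly (lagrange_poly (p + 1) \<xi> i);
         pt = (\<lambda>a. line_pt d a (\<xi> j));
         face = (\<lambda>s. fhat (uh (pt s)) (up (K, d, s) (pt s)) (edge_normal (K, d, s)))
     in 2 *\<^sub>R (\<Sum>\<alpha><\<mu>. \<Sum>\<beta><\<mu>. (\<phi> (y \<alpha>) * w \<alpha> * diff_matrix \<mu> y \<alpha> \<beta>) *\<^sub>R
                 transformed_flux2 fS K d (uh (pt (y \<alpha>))) (uh (pt (y \<beta>))))
        - (\<phi> 1 *\<^sub>R transformed_flux f K d (uh (pt 1)) - \<phi> 0 *\<^sub>R transformed_flux f K d (uh (pt 0)))
        + \<phi> 1 *\<^sub>R face 1 + \<phi> 0 *\<^sub>R face 0)"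

text \<open>Coefficients of \<open>M\<^sup>-\<^sup>1 diag(\<omega>)\<close>.\<close>

definition node_projection ::
  "nat \<Rightarrow> nat \<Rightarrow> (nat \<Rightarrow> real) \<Rightarrow> (nat \<Rightarrow> real) \<Rightarrow> (nat \<Rightarrow> real) \<Rightarrow> (nat \<Rightarrow> real) \<Rightarrow>
   nat \<Rightarrow> nat \<Rightarrow> real" where
  "node_projection p \<mu> \<xi> \<omega> y w i k = nat_matrix_inv (p + 1) (mass_matrix p \<mu> \<xi> y w) i k * \<omega> k"

text \<open>Contribution of the edges on \<open>frontier \<Omega>\<close> to the discrete entropy balance: the total
  numerical entropy flux \<open>v\<^sup>- \<bullet> fhat(u\<^sup>-, u\<^sup>+; n) - n \<bullet> \<psi>(u\<^sup>-)\<close> through these edges, at the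
  Gauss-Lobatto points of the scheme.\<close>

definition boundary_contribution ::
  "nat \<Rightarrow> (nat \<Rightarrow> real) \<Rightarrow> (nat \<Rightarrow> real) \<Rightarrow> (real^'c \<Rightarrow> real^'c) \<Rightarrow>
   (2 \<Rightarrow> real^'c \<Rightarrow> real^'c) \<Rightarrow> (2 \<Rightarrow> real^'c \<Rightarrow> real) \<Rightarrow>
   (real^'c \<Rightarrow> real^'c \<Rightarrow> real^2 \<Rightarrow> real^'c) \<Rightarrow> (real^2) set \<Rightarrow> elem set \<Rightarrow>
   (elem \<Rightarrow> real^2 \<Rightarrow> real^'c) \<Rightarrow> (elem_edge \<Rightarrow> real^2 \<Rightarrow> real^'c) \<Rightarrow> real" where
  "boundary_contribution p \<xi> \<omega> v f F fhat \<Omega> \<T> uh up =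
    (\<Sum>(K, d, s) \<in> boundary_edges \<Omega> \<T>. \<Sum>k\<le>p.
       (let x = line_pt d s (\<xi> k); n = edge_normal (K, d, s); u = uh K x
        in \<omega> k * (v u \<bullet> fhat u (up (K, d, s) x) n - (\<Sum>j\<in>UNIV. n $ j * flux_potential v f F j u))))"

end

theory Submission
  imports Defs
begin

text \<open>The time derivative of the total entropy is a quadrature sum of \<open>v \<bullet> \<partial>\<^sub>t u\<close>. Since \<open>\<partial>\<^sub>t u\<close> is a
  tensor polynomial, \<open>v\<close> may be replaced by its quadrature projection, i.e. by the entropy variables
  of the states that enter the fluxes. In the tensor product basis the quadrature form factors into
  two one-dimensional mass matrices; one of them cancels against the factor \<open>M\<^sup>-\<^sup>1 diag(\<omega>)\<close> of the
  scheme, so that the element sum becomes a sum over the lines of the scheme, weighted by the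
  positive Gauss--Lobatto weights (\<open>element_entropy_identity\<close>).

  On each line, the Gauss--Lobatto differentiation matrix satisfies summation by parts
  (\<open>diff_matrix_sbp\<close>). With a symmetric entropy-conservative two-point flux the volume term then
  collapses to end point values (\<open>sbp_entropy_identity\<close>), and what remains of the line is the
  numerical entropy flux \<open>v \<bullet> fhat - n \<bullet> \<psi>\<close> through its two end points (\<open>line_entropy_identity\<close>). The
  total entropy thus decreases at the rate of the sum of these outflows over all element edges.

  This sum is nonnegative because it can be arranged in pairs. In a conforming mesh an edge that is
  not contained in the frontier coincides with the edge of exactly one other element
  (\<open>interior_edge_shared\<close>, \<open>shared_edge_unique\<close>), and the two normals are opposite (\<open>shared_edge\<close>).
  As the neighbours may traverse the edge in opposite directions, the nodes of both sides match only
  because Gauss--Lobatto rules are symmetric, which follows from their uniqueness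
  (\<open>gauss_lobatto_nodes_unique\<close>). The outflows of a pair add up to the entropy
  dissipation of \<open>fhat\<close>, which is nonnegative. Edges in the frontier are paired by the periodic
  identification, or their total contribution vanishes by assumption.\<close>

section \<open>Lagrange interpolation and Gauss--Lobatto quadrature\<close>

lemma degree_lagrange_poly:
  assumes "i < n"
  shows "degree (lagrange_poly n x i) \<le> n - 1"
proof -
  have "degree (lagrange_poly n x i)
      \<le> sum (degree \<circ> (\<lambda>j. smult (1 / (x i - x j)) [:- x j, 1:])) ({..<n} - {i})"
    unfolding lagrange_poly_def by (rule degree_prod_sum_le) simp
  also have "\<dots> \<le> (\<Sum>j\<in>{..<n} - {i}. 1)"
    by (rule sum_mono) (simp add: degree_smult_le)
  also have "\<dots> = n - 1" using assms by simp
  finally show ?thesis .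
qed

lemma poly_lagrange_poly_node:
  assumes "inj_on x {..<n}" "i < n" "j < n"
  shows "poly (lagrange_poly n x i) (x j) = (if i = j then 1 else 0)"
proof (cases "i = j")
  case True
  have "poly (lagrange_poly n x i) (x i) = (\<Prod>j\<in>{..<n} - {i}. 1)"
    unfolding lagrange_poly_def poly_prod
  proof (rule prod.cong[OF refl])
    fix j assume "j \<in> {..<n} - {i}"
    then have "x i - x j \<noteq> 0" using assms by (auto dest: inj_onD)
    then show "poly (smult (1 / (x i - x j)) [:- x j, 1:]) (x i) = 1"
      by (simp add: diff_divide_distrib[symmetric])
  qed
  then show ?thesis using True by simp
next
  case False
  then show ?thesis
    using assms unfolding lagrange_poly_def poly_prod
    by (auto intro!: prod_zero bexI[of _ j])
qed

lemma lagrange_interpolation: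
  assumes "inj_on x {..<n}" "degree P < n"
  shows "poly P z = (\<Sum>i<n. poly (lagrange_poly n x i) z * poly P (x i))"
proof -
  have "P = (\<Sum>i<n. smult (poly P (x i)) (lagrange_poly n x i))"
  proof (rule poly_eqI_degree[of "x ` {..<n}"])
    fix z assume "z \<in> x ` {..<n}"
    then obtain j where j: "j < n" "z = x j" by auto
    have "poly (\<Sum>i<n. smult (poly P (x i)) (lagrange_poly n x i)) z
        = (\<Sum>i<n. if i = j then poly P (x i) else 0)"
      unfolding poly_sum j(2) by (rule sum.cong) (use assms j in \<open>auto simp: poly_lagrange_poly_node\<close>)
    then show "poly P z = poly (\<Sum>i<n. smult (poly P (x i)) (lagrange_poly n x i)) z"
      using j by simp
  next
    show "degree P < card (x ` {..<n})" using assms by (simp add: card_image)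
    have "degree (\<Sum>i<n. smult (poly P (x i)) (lagrange_poly n x i)) \<le> n - 1"
      by (intro degree_sum_le order_trans[OF degree_smult_le] degree_lagrange_poly) auto
    then show "degree (\<Sum>i<n. smult (poly P (x i)) (lagrange_poly n x i)) < card (x ` {..<n})"
      using assms by (simp add: card_image)
  qed
  then have "poly P z = poly (\<Sum>i<n. smult (poly P (x i)) (lagrange_poly n x i)) z" by simp
  then show ?thesis by (simp add: poly_sum mult.commute)
qed

lemma gauss_lobattoD:
  assumes "gauss_lobatto n x c"
  shows "2 \<le> n" "inj_on x {..<n}" "x 0 = 0" "x (n - 1) = 1"
    and "\<And>P. degree P \<le> 2 * n - 3 \<Longrightarrow> (\<Sum>i<n. c i * poly P (x i)) = integral {0..1} (poly P)"
    and "\<And>i j. i < j \<Longrightarrow> j < n \<Longrightarrow> x i < x j"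
  using assms unfolding gauss_lobatto_def
  by (auto simp: strict_mono_on_imp_inj_on strict_mono_on_def)

lemma gauss_lobatto_node_bounds:
  assumes "gauss_lobatto n x c" "i < n"
  shows "0 \<le> x i" "x i \<le> 1" "0 < i \<Longrightarrow> 0 < x i" "i < n - 1 \<Longrightarrow> x i < 1"
proof -
  note g = gauss_lobattoD[OF assms(1)]
  show a: "0 < i \<Longrightarrow> 0 < x i" using g(6)[of 0 i] g(3) assms by simp
  show b: "i < n - 1 \<Longrightarrow> x i < 1" using g(6)[of i "n-1"] g(4) assms by simp
  show "0 \<le> x i" using a g(3) by (cases "i = 0") auto
  show "x i \<le> 1"
  proof (cases "i < n - 1")
    case False
    then have "i = n - 1" using assms(2) by simp
    then show ?thesis using g(4) by simp
  qed (use b in simp)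
qed

lemma integral_poly_pos:
  fixes P :: "real poly"
  assumes "P \<noteq> 0" "\<And>z. z \<in> {0..1} \<Longrightarrow> 0 \<le> poly P z"
  shows "0 < integral {0..1} (poly P)"
proof -
  have "\<not> (\<forall>z\<in>{0..1}. poly P z = 0)"
  proof
    assume "\<forall>z\<in>{0..1}. poly P z = 0"
    then have "{0..1} \<subseteq> {z. poly P z = 0}" by auto
    moreover have "infinite {0..1::real}" by simp
    ultimately show False using poly_roots_finite[OF assms(1)] finite_subset by blast
  qed
  moreover have "integral {0..1} (poly P) = 0 \<longleftrightarrow> (\<forall>z\<in>{0..1}. poly P z = 0)"
    by (rule integral_eq_0_iff) (use assms in \<open>auto intro: continuous_intros\<close>)
  moreover have "0 \<le> integral {0..1} (poly P)"
    by (rule integral_nonneg)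
       (use assms in \<open>auto intro!: integrable_continuous_real continuous_intros\<close>)
  ultimately show ?thesis by linarith
qed

text \<open>The proof tests the rule with a nonnegative polynomial of degree at most \<open>2 n - 3\<close> that vanishes
  at all the other nodes, with simple roots at the end points of the interval and double roots
  inside: its integral is the weight times a nonnegative value.\<close>

lemma gauss_lobatto_weight_pos:
  assumes gl: "gauss_lobatto n x c" and k: "k < n"
  shows "0 < c k"
proof -
  note g = gauss_lobattoD[OF gl]
  define A where "A = {0<..<n-1} - {k}"
  define L :: "real poly" where "L = (if k = 0 then 1 else [:0,1:])"
  define R :: "real poly" where "R = (if k = n - 1 then 1 else [:1,-1:])"
  define Q where "Q = (\<Prod>j\<in>A. [:- x j, 1:])"
  define P where "P = L * R * Q\<^sup>2"
  have degQ: "degree Q \<le> card A"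
    unfolding Q_def by (rule order_trans[OF degree_prod_sum_le]) (auto simp: A_def)
  have degP: "degree P \<le> degree L + degree R + 2 * degree Q"
    unfolding P_def power2_eq_square
    by (intro order_trans[OF degree_mult_le] add_mono) (auto intro: order_trans[OF degree_mult_le])
  have cA: "card A = (if k = 0 \<or> k = n - 1 then n - 2 else n - 3)"
    using k unfolding A_def by (auto simp: card_Diff_singleton_if)
  have deg: "degree P \<le> 2 * n - 3"
    using degP degQ cA g(1) k unfolding L_def R_def by (auto split: if_splits)
  have P0: "P \<noteq> 0" unfolding P_def L_def R_def Q_def by (auto simp: A_def)
  have Ppos: "0 \<le> poly P z" if "z \<in> {0..1}" for z
    using that unfolding P_def L_def R_def by auto
  have zero: "poly P (x i) = 0" if "i < n" "i \<noteq> k" for i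
  proof (cases "i = 0 \<or> i = n - 1")
    case True
    then show ?thesis using that g(3,4) unfolding P_def L_def R_def by auto
  next
    case False
    then have "i \<in> A" using that unfolding A_def by auto
    then have "poly Q (x i) = 0"
      unfolding Q_def poly_prod by (intro prod_zero) (auto simp: A_def)
    then show ?thesis unfolding P_def by simp
  qed
  have "(\<Sum>i<n. c i * poly P (x i)) = (\<Sum>i<n. if i = k then c k * poly P (x k) else 0)"
    by (rule sum.cong) (use zero in auto)
  then have "c k * poly P (x k) = integral {0..1} (poly P)" using g(5)[OF deg] k by simp
  then have "0 < c k * poly P (x k)" using integral_poly_pos[OF P0 Ppos] by simp
  then show ?thesis
    using Ppos[of "x k"] gauss_lobatto_node_bounds(1,2)[OF gl k]
    by (simp add: zero_less_mult_iff not_less)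
qed

text \<open>The monic polynomial whose roots are the nodes other than the end points.\<close>

definition interior_node_poly :: "nat \<Rightarrow> (nat \<Rightarrow> real) \<Rightarrow> real poly" where
  "interior_node_poly n x = (\<Prod>j\<in>{0<..<n-1}. [:- x j, 1:])"

lemma degree_interior_node_poly: "degree (interior_node_poly n x) = n - 2"
  unfolding interior_node_poly_def by (subst degree_prod_eq_sum_degree) auto

lemma lead_coeff_interior_node_poly: "coeff (interior_node_poly n x) (n - 2) = 1"
proof -
  have "lead_coeff (interior_node_poly n x) = 1"
    unfolding interior_node_poly_def lead_coeff_prod by simp
  then show ?thesis by (simp add: degree_interior_node_poly)
qed

lemma poly_interior_node_poly_eq_0:
  "poly (interior_node_poly n x) z = 0 \<longleftrightarrow> (\<exists>j\<in>{0<..<n-1}. z = x j)"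
  unfolding interior_node_poly_def poly_prod by (auto simp: prod_zero_iff)

lemma gauss_lobatto_orthogonal:
  assumes "gauss_lobatto n x c" "degree R + 3 \<le> n"
  shows "integral {0..1} (poly ([:0,1:] * [:1,-1:] * interior_node_poly n x * R)) = 0"
proof -
  note g = gauss_lobattoD[OF assms(1)]
  have "degree ([:0,1:] * [:1,-1:] * interior_node_poly n x * R)
      \<le> 1 + 1 + degree (interior_node_poly n x) + degree R"
    by (intro order_trans[OF degree_mult_le] add_mono) auto
  also have "\<dots> \<le> 2 * n - 3" using assms(2) by (simp add: degree_interior_node_poly)
  finally have "integral {0..1} (poly ([:0,1:] * [:1,-1:] * interior_node_poly n x * R))
      = (\<Sum>i<n. c i * poly ([:0,1:] * [:1,-1:] * interior_node_poly n x * R) (x i))"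
    by (rule g(5)[symmetric])
  also have "\<dots> = 0"
  proof (rule sum.neutral, rule ballI)
    fix i assume "i \<in> {..<n}"
    then consider "i = 0" | "i = n - 1" | "i \<in> {0<..<n-1}" by fastforce
    then have "poly ([:0,1:] * [:1,-1:] * interior_node_poly n x) (x i) = 0"
      using g(3,4) poly_interior_node_poly_eq_0[of n x "x i"] by cases auto
    then show "c i * poly ([:0,1:] * [:1,-1:] * interior_node_poly n x * R) (x i) = 0"
      by (simp only: poly_mult mult_zero_left mult_zero_right)
  qed
  finally show ?thesis .
qed

text \<open>The interior nodes are the roots of the orthogonal polynomial of degree \<open>n - 2\<close> for the
  weight \<open>x (1 - x)\<close>. If two rules had different monic node polynomials, their difference
  \<open>R\<close> would have smaller degree and be orthogonal to itself.\<close>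

lemma gauss_lobatto_nodes_unique:
  assumes gl: "gauss_lobatto n x c" and gl': "gauss_lobatto n x' c'" and i: "i < n"
  shows "x i = x' i"
proof -
  note g = gauss_lobattoD[OF gl] and g' = gauss_lobattoD[OF gl']
  let ?Q = "interior_node_poly n x" and ?Q' = "interior_node_poly n x'"
  define R where "R = ?Q - ?Q'"
  have "R = 0"
  proof (rule ccontr)
    assume R0: "R \<noteq> 0"
    have "degree R \<le> n - 2" unfolding R_def
      by (rule degree_diff_le) (simp_all add: degree_interior_node_poly)
    moreover have "coeff R (n - 2) = 0"
      by (simp add: R_def lead_coeff_interior_node_poly)
    ultimately have "degree R < n - 2"
      using R0 by (metis leading_coeff_0_iff le_neq_implies_less)
    then have deg: "degree R + 3 \<le> n" by simp
    let ?S = "[:0,1:] * [:1,-1:] * R * R"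
    have S: "poly ?S = (\<lambda>z. poly ([:0,1:] * [:1,-1:] * ?Q * R) z - poly ([:0,1:] * [:1,-1:] * ?Q' * R) z)"
      unfolding R_def by (rule ext) (simp add: algebra_simps)
    have "integral {0..1} (poly ?S) = 0"
      unfolding S using gauss_lobatto_orthogonal[OF gl deg] gauss_lobatto_orthogonal[OF gl' deg]
      by (subst integral_diff) (auto intro!: integrable_continuous_real continuous_intros)
    moreover have "0 < integral {0..1} (poly ?S)"
    proof (rule integral_poly_pos)
      show "?S \<noteq> 0" using R0 by (simp only: mult_eq_0_iff) simp
      show "0 \<le> poly ?S z" if "z \<in> {0..1}" for z
      proof -
        have "poly ?S z = z * (1 - z) * (poly R z)\<^sup>2"
          by (simp add: power2_eq_square algebra_simps)
        moreover have "0 \<le> z * (1 - z) * (poly R z)\<^sup>2" using that by simp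
        ultimately show ?thesis by (simp only:)
      qed
    qed
    ultimately show False by simp
  qed
  then have QQ: "?Q = ?Q'" unfolding R_def by simp
  have split: "{..<n} = {0, n - 1} \<union> {0<..<n-1}" using g(1) by auto
  have interior: "x ` {0<..<n-1} = x' ` {0<..<n-1}"
    using poly_interior_node_poly_eq_0[of n x] poly_interior_node_poly_eq_0[of n x'] QQ by auto
  have "x ` {..<n} = x' ` {..<n}"
    unfolding split image_Un interior using g(3,4) g'(3,4) by simp
  then have "map x [0..<n] = map x' [0..<n]"
  proof (intro sorted_distinct_set_unique)
    have srt: "sorted (map z [0..<n]) \<and> distinct (map z [0..<n])" if "gauss_lobatto n z d" for z d
    proof -
      note h = gauss_lobattoD[OF that]
      have "sorted (map z [0..<n])" unfolding sorted_iff_nth_mono_less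
        using h(6) by (auto intro: less_imp_le)
      then show ?thesis using h(2) by (simp add: distinct_map atLeast0LessThan)
    qed
    show "sorted (map x [0..<n])" "distinct (map x [0..<n])"
      "sorted (map x' [0..<n])" "distinct (map x' [0..<n])"
      using srt[OF gl] srt[OF gl'] by simp_all
  qed (simp add: atLeast0LessThan)
  then show ?thesis using i by (simp add: list_eq_iff_nth_eq)
qed

lemma gauss_lobatto_weight_eq:
  assumes "gauss_lobatto n x c" "i < n"
  shows "c i = integral {0..1} (poly (lagrange_poly n x i))"
proof -
  note g = gauss_lobattoD[OF assms(1)]
  have "degree (lagrange_poly n x i) \<le> 2 * n - 3"
    using degree_lagrange_poly[OF assms(2), of x] g(1) by linarith
  then have "integral {0..1} (poly (lagrange_poly n x i))
      = (\<Sum>j<n. c j * poly (lagrange_poly n x i) (x j))" using g(5) by simp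
  also have "\<dots> = (\<Sum>j<n. if j = i then c j else 0)"
    by (rule sum.cong) (use g assms in \<open>auto simp: poly_lagrange_poly_node\<close>)
  finally show ?thesis using assms(2) by simp
qed

lemma gauss_lobatto_reflect:
  assumes "gauss_lobatto n x c"
  shows "gauss_lobatto n (\<lambda>i. 1 - x (n - 1 - i)) (\<lambda>i. c (n - 1 - i))"
proof -
  note g = gauss_lobattoD[OF assms]
  have "(\<Sum>i<n. c (n - 1 - i) * poly P (1 - x (n - 1 - i))) = integral {0..1} (poly P)"
    if deg: "degree P \<le> 2 * n - 3" for P
  proof -
    let ?P = "pcompose P [:1,-1:]"
    have "(\<Sum>i<n. c (n - 1 - i) * poly P (1 - x (n - 1 - i))) = (\<Sum>i<n. c i * poly ?P (x i))"
      by (rule sum.reindex_bij_witness[of _ "\<lambda>i. n - 1 - i" "\<lambda>i. n - 1 - i"])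
         (auto simp: poly_pcompose)
    also have "\<dots> = integral {0..1} (poly ?P)"
      by (rule g(5)) (use degree_pcompose_le[of P "[:1,-1:]"] deg in simp)
    also have "\<dots> = integral {0..1} (poly P)"
    proof (rule integral_unique)
      have "(poly P has_integral integral {0..1} (poly P)) (cbox 0 1)"
        by (auto intro!: integrable_integral integrable_continuous_real continuous_intros)
      from has_integral_affinity[OF this, of "-1" 1]
      have "((\<lambda>z. poly P (1 - z)) has_integral integral {0..1} (poly P))
          ((\<lambda>z. 1 - z) ` {0..1})" by simp
      moreover have "poly ?P = (\<lambda>z. poly P (1 - z))"
        by (rule ext) (simp add: poly_pcompose)
      ultimately show "(poly ?P has_integral integral {0..1} (poly P)) {0..1}"
        by (simp add: image_diff_atLeastAtMost)
    qed
    finally show ?thesis .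
  qed
  then show ?thesis
    unfolding gauss_lobatto_def strict_mono_on_def using g by auto
qed

lemma gauss_lobatto_symmetric:
  assumes "gauss_lobatto n x c" "i < n"
  shows "x (n - 1 - i) = 1 - x i" and "c (n - 1 - i) = c i"
proof -
  note r = gauss_lobatto_reflect[OF assms(1)]
  have eq: "x j = 1 - x (n - 1 - j)" if "j < n" for j
    using gauss_lobatto_nodes_unique[OF assms(1) r that] .
  show "x (n - 1 - i) = 1 - x i" using eq[OF assms(2)] by simp
  have "lagrange_poly n x i = lagrange_poly n (\<lambda>i. 1 - x (n - 1 - i)) i"
    unfolding lagrange_poly_def
  proof (rule prod.cong[OF refl])
    fix j assume "j \<in> {..<n} - {i}"
    then show "smult (1 / (x i - x j)) [:- x j, 1:] = smult
        (1 / (1 - x (n - 1 - i) - (1 - x (n - 1 - j)))) [:- (1 - x (n - 1 - j)), 1:]"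
      using eq[OF assms(2)] eq[of j] by (metis DiffD1 lessThan_iff)
  qed
  then show "c (n - 1 - i) = c i"
    using gauss_lobatto_weight_eq[OF assms] gauss_lobatto_weight_eq[OF r assms(2)] by simp
qed

text \<open>Summation by parts: the derivative of a product of two Lagrange polynomials has degree
  \<open>2 n - 3\<close>, so the quadrature rule integrates it exactly.\<close>

lemma diff_matrix_sbp:
  assumes gl: "gauss_lobatto n y w" and "i < n" "j < n"
  shows "w i * diff_matrix n y i j + w j * diff_matrix n y j i
      = (if i = n - 1 \<and> j = n - 1 then 1 else 0) - (if i = 0 \<and> j = 0 then 1 else 0)"
proof -
  note g = gauss_lobattoD[OF gl]
  let ?l = "lagrange_poly n y"
  let ?P = "pderiv (?l i * ?l j)"
  have "degree ?P \<le> degree (?l i) + degree (?l j) - 1"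
    by (simp add: degree_pderiv diff_le_mono degree_mult_le)
  then have "degree ?P \<le> 2 * n - 3"
    using degree_lagrange_poly[OF assms(2), of y] degree_lagrange_poly[OF assms(3), of y] g(1)
    by linarith
  then have "(\<Sum>k<n. w k * poly ?P (y k)) = integral {0..1} (poly ?P)" by (rule g(5))
  also have "\<dots> = poly (?l i * ?l j) 1 - poly (?l i * ?l j) 0"
    by (intro integral_unique fundamental_theorem_of_calculus)
       (simp_all only: has_real_derivative_iff_has_vector_derivative[symmetric]
          zero_le_one has_field_derivative_at_within[OF poly_DERIV])
  also have "\<dots> = (if i = n - 1 \<and> j = n - 1 then 1 else 0) - (if i = 0 \<and> j = 0 then 1 else 0)"
    using poly_lagrange_poly_node[OF g(2), of i 0] poly_lagrange_poly_node[OF g(2), of j 0]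
      poly_lagrange_poly_node[OF g(2), of i "n-1"] poly_lagrange_poly_node[OF g(2), of j "n-1"]
      g(1,3,4) assms by auto
  also have "(\<Sum>k<n. w k * poly ?P (y k))
      = (\<Sum>k<n. (if k = i then w k * poly (pderiv (?l j)) (y k) else 0)
             + (if k = j then w k * poly (pderiv (?l i)) (y k) else 0))"
    by (rule sum.cong)
       (use g(2) assms in \<open>auto simp: pderiv_mult poly_lagrange_poly_node algebra_simps\<close>)
  also have "\<dots> = w i * diff_matrix n y i j + w j * diff_matrix n y j i"
    using assms by (simp add: sum.distrib diff_matrix_def)
  finally show ?thesis .
qed

lemma diff_matrix_row_sum:
  assumes gl: "gauss_lobatto n y w"
  shows "(\<Sum>j<n. diff_matrix n y i j) = 0"
proof -
  note g = gauss_lobattoD[OF gl]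
  have "poly (\<Sum>j<n. lagrange_poly n y j) z = poly 1 z" for z
    using lagrange_interpolation[OF g(2), of 1 z] g(1) by (simp add: poly_sum)
  then have "(\<Sum>j<n. lagrange_poly n y j) = 1" by (metis poly_ext)
  then have "poly (pderiv (\<Sum>j<n. lagrange_poly n y j)) (y i) = 0" by simp
  then show ?thesis unfolding diff_matrix_def
    by (simp add: higher_pderiv_sum[of 1, simplified] poly_sum)
qed

section \<open>The mass matrix and the projection\<close>

text \<open>Symmetric positive definite systems are solvable: eliminating the last unknown leads to
  the Schur complement, which is again symmetric and positive definite.\<close>

lemma spd_solvable:
  fixes A :: "nat \<Rightarrow> nat \<Rightarrow> real"
  assumes "\<And>i j. i < n \<Longrightarrow> j < n \<Longrightarrow> A i j = A j i"
    and "\<And>x. \<exists>i<n. x i \<noteq> 0 \<Longrightarrow> 0 < (\<Sum>i<n. x i * (\<Sum>j<n. A i j * x j))"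
  shows "\<exists>x. \<forall>i<n. (\<Sum>j<n. A i j * x j) = b i"
  using assms
proof (induction n arbitrary: A b)
  case 0
  then show ?case by simp
next
  case (Suc n)
  define a where "a = A n n"
  have a: "0 < a"
  proof -
    let ?x = "\<lambda>i. if i = n then 1 else (0::real)"
    have "0 < (\<Sum>i<Suc n. ?x i * (\<Sum>j<Suc n. A i j * ?x j))"
      by (rule Suc.prems(2)) auto
    also have "\<dots> = a" by (simp add: a_def)
    finally show ?thesis .
  qed
  define A' where "A' = (\<lambda>i j. A i j - A i n * A n j / a)"
  have A'x: "(\<Sum>j<n. A' i j * x j) = (\<Sum>j<n. A i j * x j) - A i n / a * (\<Sum>j<n. A n j * x j)"
    for i x
    by (simp add: A'_def algebra_simps sum_subtractf sum_distrib_left)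
  have "\<exists>x. \<forall>i<n. (\<Sum>j<n. A' i j * x j) = b i - A i n * b n / a"
  proof (rule Suc.IH)
    show "A' i j = A' j i" if "i < n" "j < n" for i j
      using that Suc.prems(1)[of i j] Suc.prems(1)[of i n] Suc.prems(1)[of n j]
      by (simp add: A'_def)
    show "0 < (\<Sum>i<n. x i * (\<Sum>j<n. A' i j * x j))" if x: "\<exists>i<n. x i \<noteq> 0" for x
    proof -
      define s where "s = (\<Sum>j<n. A n j * x j)"
      \<comment> \<open>The last entry that makes the last row of the system vanish.\<close>
      define z where "z = x(n := - s / a)"
      have row: "(\<Sum>j<Suc n. A i j * z j) = (\<Sum>j<n. A' i j * x j)" for i
        unfolding A'x s_def[symmetric] by (simp add: z_def)
      have last: "(\<Sum>j<Suc n. A n j * z j) = 0"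
        using a by (simp add: z_def s_def a_def)
      have "0 < (\<Sum>i<Suc n. z i * (\<Sum>j<Suc n. A i j * z j))"
        using x by (intro Suc.prems(2)) (auto simp: z_def)
      also have "\<dots> = (\<Sum>i<n. z i * (\<Sum>j<Suc n. A i j * z j))"
        unfolding sum.lessThan_Suc[of _ n] using last by simp
      also have "\<dots> = (\<Sum>i<n. x i * (\<Sum>j<n. A' i j * x j))"
        unfolding row by (rule sum.cong) (auto simp: z_def)
      finally show ?thesis .
    qed
  qed
  then obtain x where x: "(\<Sum>j<n. A' i j * x j) = b i - A i n * b n / a" if "i < n" for i
    by blast
  define s where "s = (\<Sum>j<n. A n j * x j)"
  define z where "z = x(n := (b n - s) / a)"
  have z: "(\<Sum>j<Suc n. A i j * z j) = (\<Sum>j<n. A i j * x j) + A i n * ((b n - s) / a)" for i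
    by (simp add: z_def)
  have "(\<Sum>j<Suc n. A i j * z j) = b i" if "i < Suc n" for i
  proof (cases "i = n")
    case True
    then show ?thesis using a by (simp only: z s_def[symmetric] a_def[symmetric]) simp
  next
    case False
    then have "i < n" using that by simp
    from x[OF this] show ?thesis
      unfolding z A'x s_def[symmetric] by (simp add: algebra_simps diff_divide_distrib)
  qed
  then show ?case by blast
qed

lemma nat_matrix_inv_spd:
  fixes A :: "nat \<Rightarrow> nat \<Rightarrow> real"
  assumes sym: "\<And>i j. i < n \<Longrightarrow> j < n \<Longrightarrow> A i j = A j i"
    and pd: "\<And>x. \<exists>i<n. x i \<noteq> 0 \<Longrightarrow> 0 < (\<Sum>i<n. x i * (\<Sum>j<n. A i j * x j))"
    and ij: "i < n" "j < n"
  shows "(\<Sum>k<n. A i k * nat_matrix_inv n A k j) = (if i = j then 1 else 0)"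
proof -
  have "\<exists>x. \<forall>i<n. (\<Sum>k<n. A i k * x k) = (if i = j then 1 else 0)" for j
    by (rule spd_solvable[OF sym pd]) auto
  then obtain X where X: "(\<Sum>k<n. A i k * X j k) = (if i = j then 1 else 0)" if "i < n" for i j
    by metis
  have symX: "X i j = X j i" if "i < n" "j < n" for i j
  proof -
    have "X i j = (\<Sum>l<n. (\<Sum>k<n. A l k * X j k) * X i l)"
      using X[of _ j] that by (simp add: if_distrib[of "\<lambda>c. c * _"] cong: if_cong)
    also have "\<dots> = (\<Sum>l<n. \<Sum>k<n. A k l * X i l * X j k)"
      by (simp add: sum_distrib_right)
        (intro sum.cong refl, use sym in \<open>auto simp: mult_ac\<close>)
    also have "\<dots> = (\<Sum>k<n. (\<Sum>l<n. A k l * X i l) * X j k)"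
      by (subst sum.swap) (simp add: sum_distrib_right)
    also have "\<dots> = X j i"
      using X[of _ i] that by (simp add: if_distrib[of "\<lambda>c. c * _"] cong: if_cong)
    finally show ?thesis .
  qed
  have "\<exists>B. \<forall>i<n. \<forall>j<n. (\<Sum>k<n. A i k * B k j) = (if i = j then 1 else 0) \<and>
     (\<Sum>k<n. B i k * A k j) = (if i = j then 1 else 0)"
  proof (intro exI[of _ "\<lambda>k j. X j k"] allI impI conjI)
    fix i j assume ij: "i < n" "j < n"
    show "(\<Sum>k<n. A i k * X j k) = (if i = j then 1 else 0)" using X ij by simp
    have "(\<Sum>k<n. X k i * A k j) = (\<Sum>k<n. A j k * X i k)"
      by (rule sum.cong) (use symX sym ij in \<open>auto simp: mult.commute\<close>)
    then show "(\<Sum>k<n. X k i * A k j) = (if i = j then 1 else 0)" using X ij by auto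
  qed
  from someI_ex[OF this] show ?thesis unfolding nat_matrix_inv_def using ij by blast
qed

lemma mass_matrix_sym: "mass_matrix p \<mu> \<xi> y w i k = mass_matrix p \<mu> \<xi> y w k i"
  unfolding mass_matrix_def by (simp add: mult_ac)

lemma mass_matrix_pos_def:
  assumes gl: "gauss_lobatto (p + 1) \<xi> \<omega>" "gauss_lobatto \<mu> y w" and "p + 1 \<le> \<mu>"
    and x: "\<exists>i<p + 1. x i \<noteq> 0"
  shows "0 < (\<Sum>i<p + 1. x i * (\<Sum>j<p + 1. mass_matrix p \<mu> \<xi> y w i j * x j))"
proof -
  note g = gauss_lobattoD[OF gl(1)] and h = gauss_lobattoD[OF gl(2)]
  define P where "P = (\<Sum>i<p + 1. smult (x i) (lagrange_poly (p + 1) \<xi> i))"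
  have P: "poly P z = (\<Sum>i<p + 1. x i * poly (lagrange_poly (p + 1) \<xi> i) z)" for z
    by (simp add: P_def poly_sum)
  have "(\<Sum>i<p + 1. x i * (\<Sum>j<p + 1. mass_matrix p \<mu> \<xi> y w i j * x j))
      = (\<Sum>i<p + 1. \<Sum>j<p + 1. \<Sum>\<alpha><\<mu>. w \<alpha> *
          ((x i * interp_matrix p \<xi> y \<alpha> i) * (x j * interp_matrix p \<xi> y \<alpha> j)))"
    unfolding mass_matrix_def
    by (simp only: sum_distrib_left sum_distrib_right mult_ac)
  also have "\<dots> = (\<Sum>\<alpha><\<mu>. \<Sum>i<p + 1. \<Sum>j<p + 1. w \<alpha> *
          ((x i * interp_matrix p \<xi> y \<alpha> i) * (x j * interp_matrix p \<xi> y \<alpha> j)))"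
    by (rule trans[OF _ sum.swap], rule sum.cong[OF refl], rule sum.swap)
  also have "\<dots> = (\<Sum>\<alpha><\<mu>. w \<alpha> * (poly P (y \<alpha>))\<^sup>2)"
    unfolding P interp_matrix_def power2_eq_square
    by (simp only: sum_product) (simp only: sum_distrib_left)
  finally have eq: "(\<Sum>i<p + 1. x i * (\<Sum>j<p + 1. mass_matrix p \<mu> \<xi> y w i j * x j))
      = (\<Sum>\<alpha><\<mu>. w \<alpha> * (poly P (y \<alpha>))\<^sup>2)" .
  have nonneg: "0 \<le> w \<alpha> * (poly P (y \<alpha>))\<^sup>2" if "\<alpha> \<in> {..<\<mu>}" for \<alpha>
    using gauss_lobatto_weight_pos[OF gl(2)] that by (simp add: less_imp_le)
  have "(\<Sum>\<alpha><\<mu>. w \<alpha> * (poly P (y \<alpha>))\<^sup>2) \<noteq> 0"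
  proof
    assume "(\<Sum>\<alpha><\<mu>. w \<alpha> * (poly P (y \<alpha>))\<^sup>2) = 0"
    then have "\<forall>\<alpha>\<in>{..<\<mu>}. w \<alpha> * (poly P (y \<alpha>))\<^sup>2 = 0"
      using nonneg by (subst (asm) sum_nonneg_eq_0_iff) auto
    then have root: "poly P (y \<alpha>) = 0" if "\<alpha> < \<mu>" for \<alpha>
      using gauss_lobatto_weight_pos[OF gl(2) that] that by force
    have degP: "degree P < \<mu>"
    proof -
      have "degree P \<le> p" unfolding P_def
        by (intro degree_sum_le order_trans[OF degree_smult_le])
          (use degree_lagrange_poly[of _ "p + 1" \<xi>] in auto)
      then show ?thesis using assms(3) by simp
    qed
    have "P = 0"
    proof (rule poly_eqI_degree[of "y ` {..<\<mu>}"])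
      show "poly P z = poly 0 z" if "z \<in> y ` {..<\<mu>}" for z using that root by auto
    qed (use degP h(2) in \<open>auto simp: card_image\<close>)
    obtain i where i: "i < p + 1" "x i \<noteq> 0" using x by blast
    have "poly P (\<xi> i) = (\<Sum>j<p + 1. if j = i then x j else 0)"
      unfolding P by (rule sum.cong) (use g(2) i in \<open>auto simp: poly_lagrange_poly_node\<close>)
    then show False using i \<open>P = 0\<close> by (simp del: sum.lessThan_Suc)
  qed
  moreover have "0 \<le> (\<Sum>\<alpha><\<mu>. w \<alpha> * (poly P (y \<alpha>))\<^sup>2)" by (rule sum_nonneg) (rule nonneg)
  ultimately show ?thesis unfolding eq by linarith
qed

text \<open>The role of the factor \<open>M\<^sup>-\<^sup>1 diag(\<omega>)\<close>: it turns the transverse mass matrix into the diagonal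
  matrix of the nodal weights.\<close>

lemma mass_matrix_node_projection:
  fixes a :: "nat \<Rightarrow> 'a :: real_vector"
  assumes gl: "gauss_lobatto (p + 1) \<xi> \<omega>" "gauss_lobatto \<mu> y w" and "p + 1 \<le> \<mu>" and j: "j \<le> p"
  shows "(\<Sum>l\<le>p. mass_matrix p \<mu> \<xi> y w j l *\<^sub>R (\<Sum>k\<le>p. node_projection p \<mu> \<xi> \<omega> y w l k *\<^sub>R a k))
      = \<omega> j *\<^sub>R a j"
proof -
  let ?M = "mass_matrix p \<mu> \<xi> y w"
  have inv: "(\<Sum>l\<le>p. ?M j l * nat_matrix_inv (p + 1) ?M l k) = (if j = k then 1 else 0)"
    if "k \<le> p" for k
    using nat_matrix_inv_spd[of "p + 1" ?M j k,
        OF mass_matrix_sym mass_matrix_pos_def[OF gl assms(3)]] that j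
    by (simp add: lessThan_Suc_atMost)
  have "(\<Sum>l\<le>p. ?M j l *\<^sub>R (\<Sum>k\<le>p. node_projection p \<mu> \<xi> \<omega> y w l k *\<^sub>R a k))
      = (\<Sum>k\<le>p. (\<Sum>l\<le>p. ?M j l * nat_matrix_inv (p + 1) ?M l k) *\<^sub>R \<omega> k *\<^sub>R a k)"
    unfolding node_projection_def
    by (simp add: scaleR_sum_right scaleR_sum_left mult.assoc sum_distrib_right) (rule sum.swap)
  also have "\<dots> = (\<Sum>k\<le>p. if k = j then \<omega> k *\<^sub>R a k else 0)"
    by (rule sum.cong) (use inv in auto)
  finally show ?thesis using j by simp
qed

lemma line_pt_vector: "line_pt 1 a b = vector [a, b]" "line_pt 2 a b = vector [b, a]"
  by (auto simp: line_pt_def vec_eq_iff forall_2)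

lemma line_pt_nth: "line_pt d a b $ d = a" "i \<noteq> d \<Longrightarrow> line_pt d a b $ i = b"
  by (auto simp: line_pt_def)

lemma tensor_poly_interpolation:
  fixes h :: "real^2 \<Rightarrow> real^'c"
  assumes "h \<in> tensor_polys p" and inj: "inj_on \<xi> {..<p + 1}"
  shows "h (line_pt d a b)
    = (\<Sum>i\<le>p. poly (lagrange_poly (p + 1) \<xi> i) a *\<^sub>R h (line_pt d (\<xi> i) b))"
proof -
  obtain c where c: "\<And>x. h x = (\<Sum>k\<le>p. \<Sum>l\<le>p. (x $ 1 ^ k * x $ 2 ^ l) *\<^sub>R c k l)"
    using assms(1) unfolding tensor_polys_def by blast
  have "\<exists>e. \<forall>a. h (line_pt d a b) = (\<Sum>k\<le>p. (a ^ k) *\<^sub>R e k)"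
  proof (cases "d = 1")
    case True
    show ?thesis
      by (rule exI[of _ "\<lambda>k. \<Sum>l\<le>p. (b ^ l) *\<^sub>R c k l"])
        (simp add: c True line_pt_vector scaleR_sum_right)
  next
    case False
    then have "d = 2" using exhaust_2 by blast
    then show ?thesis
      by (intro exI[of _ "\<lambda>l. \<Sum>k\<le>p. (b ^ k) *\<^sub>R c k l"])
        (auto simp: c line_pt_vector scaleR_sum_right mult.commute intro: sum.swap)
  qed
  then obtain e where e: "\<And>a. h (line_pt d a b) = (\<Sum>k\<le>p. (a ^ k) *\<^sub>R e k)" by blast
  have pow: "a ^ k = (\<Sum>i\<le>p. poly (lagrange_poly (p + 1) \<xi> i) a * \<xi> i ^ k)" if "k \<le> p" for k
    using lagrange_interpolation[OF inj, of "monom 1 k" a] that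
    by (simp add: degree_monom_eq poly_monom lessThan_Suc_atMost)
  have "h (line_pt d a b) = (\<Sum>k\<le>p. (\<Sum>i\<le>p. poly (lagrange_poly (p + 1) \<xi> i) a * \<xi> i ^ k) *\<^sub>R e k)"
    unfolding e by (rule sum.cong) (use pow in auto)
  also have "\<dots> = (\<Sum>i\<le>p. poly (lagrange_poly (p + 1) \<xi> i) a *\<^sub>R h (line_pt d (\<xi> i) b))"
    unfolding e by (simp add: scaleR_sum_left scaleR_sum_right) (rule sum.swap)
  finally show ?thesis .
qed

lemma nodal_poly_in_tensor_polys: "nodal_poly p \<xi> a \<in> tensor_polys p"
proof -
  let ?l = "lagrange_poly (p + 1) \<xi>"
  have l: "poly (?l i) z = (\<Sum>k\<le>p. coeff (?l i) k * z ^ k)" if "i \<le> p" for i z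
    using degree_lagrange_poly[of i "p + 1" \<xi>] that
    by (subst poly_altdef) (auto intro!: sum.mono_neutral_left le_degree)
  have "nodal_poly p \<xi> a x = (\<Sum>k\<le>p. \<Sum>l\<le>p. (x $ 1 ^ k * x $ 2 ^ l) *\<^sub>R
      (\<Sum>i\<le>p. \<Sum>j\<le>p. (coeff (?l i) k * coeff (?l j) l) *\<^sub>R a i j))" for x
  proof -
    have "nodal_poly p \<xi> a x = (\<Sum>i\<le>p. \<Sum>j\<le>p.
        ((\<Sum>k\<le>p. coeff (?l i) k * x $ 1 ^ k) * (\<Sum>l\<le>p. coeff (?l j) l * x $ 2 ^ l)) *\<^sub>R a i j)"
      unfolding nodal_poly_def by (intro sum.cong refl) (simp only: l atMost_iff)
    also have "\<dots> = (\<Sum>i\<le>p. \<Sum>j\<le>p. \<Sum>k\<le>p. \<Sum>l\<le>p.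
        ((x $ 1 ^ k * x $ 2 ^ l) * (coeff (?l i) k * coeff (?l j) l)) *\<^sub>R a i j)"
      by (simp only: sum_product scaleR_sum_left mult_ac)
    also have "\<dots> = (\<Sum>i\<le>p. \<Sum>k\<le>p. \<Sum>l\<le>p. \<Sum>j\<le>p.
        ((x $ 1 ^ k * x $ 2 ^ l) * (coeff (?l i) k * coeff (?l j) l)) *\<^sub>R a i j)"
      by (rule sum.cong[OF refl], subst sum.swap, rule sum.cong[OF refl], rule sum.swap)
    also have "\<dots> = (\<Sum>k\<le>p. \<Sum>l\<le>p. \<Sum>i\<le>p. \<Sum>j\<le>p.
        ((x $ 1 ^ k * x $ 2 ^ l) * (coeff (?l i) k * coeff (?l j) l)) *\<^sub>R a i j)"
      by (subst sum.swap, rule sum.cong[OF refl], rule sum.swap)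
    finally show ?thesis by (simp add: scaleR_sum_right)
  qed
  then show ?thesis unfolding tensor_polys_def by (intro CollectI exI allI)
qed

lemma quadrature_mass_matrix:
  fixes H X c :: "nat \<Rightarrow> 'a :: real_inner"
  assumes H: "\<And>\<beta>. \<beta> < \<mu> \<Longrightarrow> H \<beta> = (\<Sum>j\<le>p. poly (lagrange_poly (p + 1) \<xi> j) (y \<beta>) *\<^sub>R X j)"
  shows "(\<Sum>\<beta><\<mu>. w \<beta> * (H \<beta> \<bullet> (\<Sum>l\<le>p. poly (lagrange_poly (p + 1) \<xi> l) (y \<beta>) *\<^sub>R c l)))
    = (\<Sum>j\<le>p. X j \<bullet> (\<Sum>l\<le>p. mass_matrix p \<mu> \<xi> y w j l *\<^sub>R c l))"
proof -
  let ?G = "interp_matrix p \<xi> y"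
  have "(\<Sum>\<beta><\<mu>. w \<beta> * (H \<beta> \<bullet> (\<Sum>l\<le>p. poly (lagrange_poly (p + 1) \<xi> l) (y \<beta>) *\<^sub>R c l)))
      = (\<Sum>\<beta><\<mu>. \<Sum>j\<le>p. \<Sum>l\<le>p. (?G \<beta> j * w \<beta> * ?G \<beta> l) * (X j \<bullet> c l))"
  proof (rule sum.cong[OF refl])
    fix \<beta> assume "\<beta> \<in> {..<\<mu>}"
    then have "H \<beta> = (\<Sum>j\<le>p. ?G \<beta> j *\<^sub>R X j)" using H unfolding interp_matrix_def by simp
    then show "w \<beta> * (H \<beta> \<bullet> (\<Sum>l\<le>p. poly (lagrange_poly (p + 1) \<xi> l) (y \<beta>) *\<^sub>R c l))
        = (\<Sum>j\<le>p. \<Sum>l\<le>p. (?G \<beta> j * w \<beta> * ?G \<beta> l) * (X j \<bullet> c l))"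
      unfolding interp_matrix_def[symmetric]
      by (simp only: inner_sum_left, simp add: inner_sum_right sum_distrib_left mult_ac)
  qed
  also have "\<dots> = (\<Sum>j\<le>p. \<Sum>l\<le>p. \<Sum>\<beta><\<mu>. (?G \<beta> j * w \<beta> * ?G \<beta> l) * (X j \<bullet> c l))"
    by (rule trans[OF sum.swap], rule sum.cong[OF refl], rule sum.swap)
  also have "\<dots> = (\<Sum>j\<le>p. X j \<bullet> (\<Sum>l\<le>p. mass_matrix p \<mu> \<xi> y w j l *\<^sub>R c l))"
    by (simp add: mass_matrix_def inner_sum_right sum_distrib_right)
  finally show ?thesis .
qed

text \<open>In the tensor product basis, the two-dimensional quadrature form is the product of two mass
  matrices.\<close>

lemma quadrature_tensor_mass_matrix:
  fixes h :: "real^2 \<Rightarrow> real^'c"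
  assumes h: "h \<in> tensor_polys p" and inj: "inj_on \<xi> {..<p + 1}"
  shows "(\<Sum>\<alpha><\<mu>. \<Sum>\<beta><\<mu>. w \<alpha> * w \<beta> *
        (h (vector [y \<alpha>, y \<beta>]) \<bullet> nodal_poly p \<xi> a (vector [y \<alpha>, y \<beta>])))
    = (\<Sum>j\<le>p. \<Sum>i\<le>p. h (vector [\<xi> i, \<xi> j]) \<bullet>
        (\<Sum>k\<le>p. mass_matrix p \<mu> \<xi> y w i k *\<^sub>R (\<Sum>l\<le>p. mass_matrix p \<mu> \<xi> y w j l *\<^sub>R a k l)))"
proof -
  let ?l = "\<lambda>i. poly (lagrange_poly (p + 1) \<xi> i)"
  let ?M = "mass_matrix p \<mu> \<xi> y w"
  have nodal: "nodal_poly p \<xi> a (vector [s, t]) = (\<Sum>l\<le>p. ?l l t *\<^sub>R (\<Sum>k\<le>p. ?l k s *\<^sub>R a k l))" for s t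
    unfolding nodal_poly_def
    by (subst sum.swap) (simp add: scaleR_sum_right mult.commute)
  have inner: "(\<Sum>\<beta><\<mu>. w \<beta> * (h (vector [s, y \<beta>]) \<bullet> (\<Sum>l\<le>p. ?l l (y \<beta>) *\<^sub>R c l)))
      = (\<Sum>j\<le>p. h (vector [s, \<xi> j]) \<bullet> (\<Sum>l\<le>p. ?M j l *\<^sub>R c l))" for s c
    by (rule quadrature_mass_matrix[where H = "\<lambda>\<beta>. h (vector [s, y \<beta>])"
          and X = "\<lambda>j. h (vector [s, \<xi> j])" and c = c])
      (rule tensor_poly_interpolation[OF h inj, of 2, unfolded line_pt_vector])
  have outer: "(\<Sum>\<alpha><\<mu>. w \<alpha> * (h (vector [y \<alpha>, t]) \<bullet> (\<Sum>k\<le>p. ?l k (y \<alpha>) *\<^sub>R c k)))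
      = (\<Sum>i\<le>p. h (vector [\<xi> i, t]) \<bullet> (\<Sum>k\<le>p. ?M i k *\<^sub>R c k))" for t c
    by (rule quadrature_mass_matrix[where H = "\<lambda>\<alpha>. h (vector [y \<alpha>, t])"
          and X = "\<lambda>i. h (vector [\<xi> i, t])" and c = c])
      (rule tensor_poly_interpolation[OF h inj, of 1, unfolded line_pt_vector])
  have "(\<Sum>\<alpha><\<mu>. \<Sum>\<beta><\<mu>. w \<alpha> * w \<beta> *
        (h (vector [y \<alpha>, y \<beta>]) \<bullet> nodal_poly p \<xi> a (vector [y \<alpha>, y \<beta>])))
      = (\<Sum>\<alpha><\<mu>. w \<alpha> * (\<Sum>\<beta><\<mu>. w \<beta> * (h (vector [y \<alpha>, y \<beta>]) \<bullet>
          (\<Sum>l\<le>p. ?l l (y \<beta>) *\<^sub>R (\<Sum>k\<le>p. ?l k (y \<alpha>) *\<^sub>R a k l)))))"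
    unfolding nodal by (simp add: sum_distrib_left mult.assoc)
  also have "\<dots> = (\<Sum>\<alpha><\<mu>. w \<alpha> * (\<Sum>j\<le>p. h (vector [y \<alpha>, \<xi> j]) \<bullet>
          (\<Sum>l\<le>p. ?M j l *\<^sub>R (\<Sum>k\<le>p. ?l k (y \<alpha>) *\<^sub>R a k l))))"
    by (simp only: inner)
  also have "\<dots> = (\<Sum>\<alpha><\<mu>. \<Sum>j\<le>p. w \<alpha> * (h (vector [y \<alpha>, \<xi> j]) \<bullet>
          (\<Sum>k\<le>p. ?l k (y \<alpha>) *\<^sub>R (\<Sum>l\<le>p. ?M j l *\<^sub>R a k l))))"
  proof -
    have "(\<Sum>l\<le>p. ?M j l *\<^sub>R (\<Sum>k\<le>p. ?l k s *\<^sub>R a k l))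
        = (\<Sum>k\<le>p. ?l k s *\<^sub>R (\<Sum>l\<le>p. ?M j l *\<^sub>R a k l))" for j s
      unfolding scaleR_sum_right scaleR_left_commute[of "?M _ _"] by (rule sum.swap)
    then show ?thesis by (simp add: sum_distrib_left)
  qed
  also have "\<dots> = (\<Sum>j\<le>p. \<Sum>\<alpha><\<mu>. w \<alpha> * (h (vector [y \<alpha>, \<xi> j]) \<bullet>
          (\<Sum>k\<le>p. ?l k (y \<alpha>) *\<^sub>R (\<Sum>l\<le>p. ?M j l *\<^sub>R a k l))))"
    by (rule sum.swap)
  also have "\<dots> = (\<Sum>j\<le>p. \<Sum>i\<le>p. h (vector [\<xi> i, \<xi> j]) \<bullet>
        (\<Sum>k\<le>p. ?M i k *\<^sub>R (\<Sum>l\<le>p. ?M j l *\<^sub>R a k l)))"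
    by (simp only: outer)
  finally show ?thesis .
qed

section \<open>The entropy balance on one line\<close>

text \<open>The discrete entropy identity for a summation-by-parts operator and a symmetric two-point
  flux. Since \<open>v \<alpha> \<bullet> f \<alpha> \<beta> - \<psi> \<alpha>\<close> is symmetric in \<open>\<alpha>\<close> and \<open>\<beta>\<close>, only the symmetric part of
  \<open>W D\<close>, which is concentrated at the end points, contributes.\<close>

lemma sbp_entropy_identity:
  fixes v :: "nat \<Rightarrow> 'a :: real_inner" and \<psi> :: "nat \<Rightarrow> real"
  assumes gl: "gauss_lobatto n y w"
    and sym: "\<And>\<alpha> \<beta>. \<alpha> < n \<Longrightarrow> \<beta> < n \<Longrightarrow> f \<alpha> \<beta> = f \<beta> \<alpha>"
    and shuffle: "\<And>\<alpha> \<beta>. \<alpha> < n \<Longrightarrow> \<beta> < n \<Longrightarrow> (v \<beta> - v \<alpha>) \<bullet> f \<alpha> \<beta> = \<psi> \<beta> - \<psi> \<alpha>"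
  shows "2 * (\<Sum>\<alpha><n. \<Sum>\<beta><n. w \<alpha> * diff_matrix n y \<alpha> \<beta> * (v \<alpha> \<bullet> f \<alpha> \<beta>))
    = (v (n - 1) \<bullet> f (n - 1) (n - 1) - \<psi> (n - 1)) - (v 0 \<bullet> f 0 0 - \<psi> 0)"
proof -
  have n: "0 < n" using gauss_lobattoD(1)[OF gl] by simp
  let ?D = "diff_matrix n y"
  define X where "X = (\<lambda>\<alpha> \<beta>. w \<alpha> * ?D \<alpha> \<beta> * (v \<alpha> \<bullet> f \<alpha> \<beta> - \<psi> \<alpha>))"
  have "(\<Sum>\<beta><n. w \<alpha> * ?D \<alpha> \<beta> * \<psi> \<alpha>) = 0" for \<alpha>
    using diff_matrix_row_sum[OF gl, of \<alpha>]
    by (simp flip: sum_distrib_left sum_distrib_right)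
  then have "(\<Sum>\<alpha><n. \<Sum>\<beta><n. w \<alpha> * ?D \<alpha> \<beta> * (v \<alpha> \<bullet> f \<alpha> \<beta>)) = (\<Sum>\<alpha><n. \<Sum>\<beta><n. X \<alpha> \<beta>)"
    by (simp add: X_def right_diff_distrib sum_subtractf)
  then have "2 * (\<Sum>\<alpha><n. \<Sum>\<beta><n. w \<alpha> * ?D \<alpha> \<beta> * (v \<alpha> \<bullet> f \<alpha> \<beta>))
      = (\<Sum>\<alpha><n. \<Sum>\<beta><n. X \<alpha> \<beta>) + (\<Sum>\<beta><n. \<Sum>\<alpha><n. X \<alpha> \<beta>)"
    using sum.swap[of X "{..<n}" "{..<n}"] by simp
  also have "\<dots> = (\<Sum>\<alpha><n. \<Sum>\<beta><n. X \<alpha> \<beta> + X \<beta> \<alpha>)"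
    by (simp add: sum.distrib)
  also have "\<dots> = (\<Sum>\<alpha><n. \<Sum>\<beta><n.
      (if \<alpha> = n - 1 \<and> \<beta> = n - 1 then v (n - 1) \<bullet> f (n - 1) (n - 1) - \<psi> (n - 1) else 0)
      - (if \<alpha> = 0 \<and> \<beta> = 0 then v 0 \<bullet> f 0 0 - \<psi> 0 else 0))"
  proof (intro sum.cong refl)
    fix \<alpha> \<beta> assume ab: "\<alpha> \<in> {..<n}" "\<beta> \<in> {..<n}"
    then have "v \<beta> \<bullet> f \<beta> \<alpha> - \<psi> \<beta> = v \<alpha> \<bullet> f \<alpha> \<beta> - \<psi> \<alpha>"
      using sym[of \<alpha> \<beta>] shuffle[of \<alpha> \<beta>] by (simp add: inner_diff_left)
    then have "X \<alpha> \<beta> + X \<beta> \<alpha> = (w \<alpha> * ?D \<alpha> \<beta> + w \<beta> * ?D \<beta> \<alpha>) * (v \<alpha> \<bullet> f \<alpha> \<beta> - \<psi> \<alpha>)"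
      by (simp add: X_def distrib_right)
    then show "X \<alpha> \<beta> + X \<beta> \<alpha>
      = (if \<alpha> = n - 1 \<and> \<beta> = n - 1 then v (n - 1) \<bullet> f (n - 1) (n - 1) - \<psi> (n - 1) else 0)
      - (if \<alpha> = 0 \<and> \<beta> = 0 then v 0 \<bullet> f 0 0 - \<psi> 0 else 0)"
      using ab by (auto simp: diff_matrix_sbp[OF gl])
  qed
  also have "\<dots> = (v (n - 1) \<bullet> f (n - 1) (n - 1) - \<psi> (n - 1)) - (v 0 \<bullet> f 0 0 - \<psi> 0)"
  proof -
    have delta: "(\<Sum>\<alpha><n. \<Sum>\<beta><n. if \<alpha> = k \<and> \<beta> = k then c else 0) = (c :: real)" if "k < n" for k c
    proof -
      have "(\<Sum>\<alpha><n. \<Sum>\<beta><n. if \<alpha> = k \<and> \<beta> = k then c else 0) = (\<Sum>\<alpha><n. if \<alpha> = k then c else 0)"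
        using that by (intro sum.cong refl) auto
      then show ?thesis using that by simp
    qed
    show ?thesis using n by (simp add: sum_subtractf delta)
  qed
  finally show ?thesis .
qed

text \<open>The numerical entropy flux \<open>v \<bullet> fhat - n \<bullet> \<psi>\<close> that leaves an element through its edge \<open>e\<close> at the
  reference point \<open>x\<close>. Both \<open>v\<close> and \<open>\<psi>\<close> are evaluated at the interior trace, so the two sides of
  an edge see different values; if both traces agree, this is the physical flux \<open>n \<bullet> F\<close>.\<close>

definition edge_entropy_flux ::
  "(real^'c \<Rightarrow> real^'c) \<Rightarrow> (2 \<Rightarrow> real^'c \<Rightarrow> real^'c) \<Rightarrow> (2 \<Rightarrow> real^'c \<Rightarrow> real) \<Rightarrow>
   (real^'c \<Rightarrow> real^'c \<Rightarrow> real^2 \<Rightarrow> real^'c) \<Rightarrow> (elem \<Rightarrow> real^2 \<Rightarrow> real^'c) \<Rightarrow>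
   (elem_edge \<Rightarrow> real^2 \<Rightarrow> real^'c) \<Rightarrow> elem_edge \<Rightarrow> real^2 \<Rightarrow> real" where
  "edge_entropy_flux v f F fhat uh up e x =
    v (uh (fst e) x) \<bullet> fhat (uh (fst e) x) (up e x) (edge_normal e)
      - (\<Sum>j\<in>UNIV. edge_normal e $ j * flux_potential v f F j (uh (fst e) x))"

lemma ref_normal_inner: "ref_normal d s \<bullet> z = (if s = 1 then z $ d else - z $ d)"
  by (simp add: ref_normal_def inner_axis' inner_minus_left)

lemma edge_normal_nth:
  "edge_normal (K, d, s) $ j = (if s = 1 then 1 else - 1) * (jdet K * matrix_inv (jac K) $ d $ j)"
proof -
  have "(transpose A *v ref_normal d s) $ j = ref_normal d s \<bullet> (\<chi> i. A $ i $ j)" for A :: "real^2^2"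
    by (simp add: matrix_vector_mult_def transpose_def inner_vec_def mult.commute)
  then show ?thesis
    unfolding edge_normal_def by (simp add: ref_normal_inner del: transpose_matrix_vector)
qed

text \<open>Testing the line operator with the projected entropy variables leaves only the entropy outflow
  through the two end points of the line.\<close>

lemma line_entropy_identity:
  fixes h :: "real^2 \<Rightarrow> real^'c" and uh :: "elem \<Rightarrow> real^2 \<Rightarrow> real^'c"
  assumes gl: "gauss_lobatto (p + 1) \<xi> \<omega>" "gauss_lobatto \<mu> y w"
    and ec: "entropy_conservative_flux D v f F fS"
    and h: "h \<in> tensor_polys p"
    and uD: "\<And>\<alpha>. \<alpha> < \<mu> \<Longrightarrow> uh K (line_pt d (y \<alpha>) (\<xi> j)) \<in> D"
    and vu: "\<And>\<alpha>. \<alpha> < \<mu> \<Longrightarrow> v (uh K (line_pt d (y \<alpha>) (\<xi> j))) = h (line_pt d (y \<alpha>) (\<xi> j))"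
  shows "(\<Sum>i\<le>p. h (line_pt d (\<xi> i) (\<xi> j)) \<bullet> line_rhs p \<mu> \<xi> y w f fS fhat K (uh K) up d i j)
    = (\<Sum>s\<in>{0,1}. edge_entropy_flux v f F fhat uh up (K, d, s) (line_pt d s (\<xi> j)))"
proof -
  note g = gauss_lobattoD[OF gl(1)] and gy = gauss_lobattoD[OF gl(2)]
  define H where "H = (\<lambda>a. h (line_pt d a (\<xi> j)))"
  define u where "u = (\<lambda>a. uh K (line_pt d a (\<xi> j)))"
  define face where
    "face = (\<lambda>s. fhat (u s) (up (K, d, s) (line_pt d s (\<xi> j))) (edge_normal (K, d, s)))"
  define c where "c = (\<lambda>k. jdet K * matrix_inv (jac K) $ d $ k)"
  define T where "T = (\<lambda>\<alpha> \<beta>. transformed_flux2 fS K d (u (y \<alpha>)) (u (y \<beta>)))"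
  define \<Psi> where "\<Psi> = (\<lambda>a. \<Sum>k\<in>UNIV. c k * flux_potential v f F k (u a))"
  have T: "T \<alpha> \<beta> = (\<Sum>k\<in>UNIV. c k *\<^sub>R fS k (u (y \<alpha>)) (u (y \<beta>)))" for \<alpha> \<beta>
    by (simp add: T_def transformed_flux2_def c_def scaleR_sum_right)
  have uD': "u (y \<alpha>) \<in> D" and vu': "v (u (y \<alpha>)) = H (y \<alpha>)" if "\<alpha> < \<mu>" for \<alpha>
    using uD vu that by (auto simp: u_def H_def)
  have fS: "fS k a a = f k a" "fS k a b = fS k b a"
    "(v b - v a) \<bullet> fS k a b = flux_potential v f F k b - flux_potential v f F k a"
    if "a \<in> D" "b \<in> D" for k a b
    using ec that unfolding entropy_conservative_flux_def by blast+
  have ends: "y 0 = 0" "y (\<mu> - 1) = 1" "0 < \<mu>" "\<mu> - 1 < \<mu>" using gy(1,3,4) by auto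
  have test: "(\<Sum>i\<le>p. h (line_pt d (\<xi> i) (\<xi> j)) \<bullet> (poly (lagrange_poly (p + 1) \<xi> i) a *\<^sub>R z)) = H a \<bullet> z"
    for a z
    unfolding H_def by (subst tensor_poly_interpolation[OF h g(2)]) (simp add: inner_sum_left)
  have diag: "T \<alpha> \<alpha> = transformed_flux f K d (u (y \<alpha>))" if "\<alpha> < \<mu>" for \<alpha>
    unfolding T transformed_flux_def using fS(1)[OF uD'[OF that] uD'[OF that]]
    by (simp add: c_def scaleR_sum_right)
  have volume: "2 * (\<Sum>\<alpha><\<mu>. \<Sum>\<beta><\<mu>. w \<alpha> * diff_matrix \<mu> y \<alpha> \<beta> * (H (y \<alpha>) \<bullet> T \<alpha> \<beta>))
      = (H (y (\<mu> - 1)) \<bullet> T (\<mu> - 1) (\<mu> - 1) - \<Psi> (y (\<mu> - 1))) - (H (y 0) \<bullet> T 0 0 - \<Psi> (y 0))"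
  proof (rule sbp_entropy_identity[OF gl(2)])
    fix \<alpha> \<beta> assume ab: "\<alpha> < \<mu>" "\<beta> < \<mu>"
    show "T \<alpha> \<beta> = T \<beta> \<alpha>" unfolding T by (rule sum.cong) (use fS(2) uD' ab in auto)
    show "(H (y \<beta>) - H (y \<alpha>)) \<bullet> T \<alpha> \<beta> = \<Psi> (y \<beta>) - \<Psi> (y \<alpha>)"
      unfolding T \<Psi>_def vu'[OF ab(1), symmetric] vu'[OF ab(2), symmetric]
      by (simp add: inner_sum_right fS(3)[OF uD'[OF ab(1)] uD'[OF ab(2)]] right_diff_distrib
          sum_subtractf)
  qed
  have "(\<Sum>i\<le>p. h (line_pt d (\<xi> i) (\<xi> j)) \<bullet> line_rhs p \<mu> \<xi> y w f fS fhat K (uh K) up d i j)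
      = 2 * (\<Sum>\<alpha><\<mu>. \<Sum>\<beta><\<mu>. w \<alpha> * diff_matrix \<mu> y \<alpha> \<beta> * (H (y \<alpha>) \<bullet> T \<alpha> \<beta>))
        - (H 1 \<bullet> transformed_flux f K d (u 1) - H 0 \<bullet> transformed_flux f K d (u 0))
        + H 1 \<bullet> face 1 + H 0 \<bullet> face 0"
  proof -
    let ?\<phi> = "\<lambda>i. poly (lagrange_poly (p + 1) \<xi> i)"
    let ?X = "\<lambda>i. h (line_pt d (\<xi> i) (\<xi> j))"
    have rhs: "line_rhs p \<mu> \<xi> y w f fS fhat K (uh K) up d i j =
        2 *\<^sub>R (\<Sum>\<alpha><\<mu>. \<Sum>\<beta><\<mu>. (?\<phi> i (y \<alpha>) * w \<alpha> * diff_matrix \<mu> y \<alpha> \<beta>) *\<^sub>R T \<alpha> \<beta>)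
        - (?\<phi> i 1 *\<^sub>R transformed_flux f K d (u 1) - ?\<phi> i 0 *\<^sub>R transformed_flux f K d (u 0))
        + ?\<phi> i 1 *\<^sub>R face 1 + ?\<phi> i 0 *\<^sub>R face 0" for i
      unfolding line_rhs_def Let_def T_def face_def u_def ..
    have "(\<Sum>i\<le>p. ?X i \<bullet> (\<Sum>\<alpha><\<mu>. \<Sum>\<beta><\<mu>. (?\<phi> i (y \<alpha>) * w \<alpha> * diff_matrix \<mu> y \<alpha> \<beta>) *\<^sub>R T \<alpha> \<beta>))
        = (\<Sum>\<alpha><\<mu>. \<Sum>\<beta><\<mu>. \<Sum>i\<le>p. ?X i \<bullet> (?\<phi> i (y \<alpha>) *\<^sub>R (w \<alpha> * diff_matrix \<mu> y \<alpha> \<beta>) *\<^sub>R T \<alpha> \<beta>))"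
      unfolding inner_sum_right mult.assoc scaleR_scaleR
      by (rule trans[OF sum.swap], rule sum.cong[OF refl], rule sum.swap)
    also have "\<dots> = (\<Sum>\<alpha><\<mu>. \<Sum>\<beta><\<mu>. w \<alpha> * diff_matrix \<mu> y \<alpha> \<beta> * (H (y \<alpha>) \<bullet> T \<alpha> \<beta>))"
      unfolding test by simp
    finally have vol: "(\<Sum>i\<le>p. ?X i \<bullet>
        (\<Sum>\<alpha><\<mu>. \<Sum>\<beta><\<mu>. (?\<phi> i (y \<alpha>) * w \<alpha> * diff_matrix \<mu> y \<alpha> \<beta>) *\<^sub>R T \<alpha> \<beta>))
      = (\<Sum>\<alpha><\<mu>. \<Sum>\<beta><\<mu>. w \<alpha> * diff_matrix \<mu> y \<alpha> \<beta> * (H (y \<alpha>) \<bullet> T \<alpha> \<beta>))" .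
    show ?thesis
      unfolding rhs inner_add_right inner_diff_right sum.distrib sum_subtractf test
        inner_scaleR_right[of _ 2] sum_distrib_left[symmetric] vol ..
  qed
  also have "\<dots> = (H 1 \<bullet> face 1 - \<Psi> 1) + (H 0 \<bullet> face 0 + \<Psi> 0)"
    unfolding volume using diag[of 0] diag[of "\<mu> - 1"] ends by simp
  also have "H 1 \<bullet> face 1 - \<Psi> 1 = edge_entropy_flux v f F fhat uh up (K, d, 1) (line_pt d 1 (\<xi> j))"
    using vu'[of "\<mu> - 1"] ends
    by (simp add: edge_entropy_flux_def face_def \<Psi>_def c_def edge_normal_nth u_def)
  also have "H 0 \<bullet> face 0 + \<Psi> 0 = edge_entropy_flux v f F fhat uh up (K, d, 0) (line_pt d 0 (\<xi> j))"
    using vu'[of 0] ends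
    by (simp add: edge_entropy_flux_def face_def \<Psi>_def c_def edge_normal_nth u_def sum_negf)
  finally show ?thesis by simp
qed

section \<open>Geometry of shared edges\<close>

lemma jac_inverse:
  assumes "jdet K > 0"
  shows "jac K *v (matrix_inv (jac K) *v z) = z" "matrix_inv (jac K) *v (jac K *v z) = z"
proof -
  have "invertible (jac K)" using assms by (simp add: invertible_det_nz)
  then show "jac K *v (matrix_inv (jac K) *v z) = z" "matrix_inv (jac K) *v (jac K *v z) = z"
    using someI_ex[of "\<lambda>B. jac K ** B = mat 1 \<and> B ** jac K = mat 1"]
    unfolding invertible_def matrix_inv_def by (simp_all add: matrix_vector_mul_assoc)
qed

lemma elem_map_diff: "elem_map K x - elem_map K z = jac K *v (x - z)"
  by (simp add: elem_map_def matrix_vector_mult_diff_distrib)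

lemma elem_map_inject:
  assumes "jdet K > 0"
  shows "elem_map K x = elem_map K z \<longleftrightarrow> x = z"
  by (metis assms elem_map_diff jac_inverse(2) right_minus_eq matrix_vector_mult_0_right)

lemma edge_normal_inner:
  assumes "jdet K > 0"
  shows "edge_normal (K, d, s) \<bullet> (jac K *v z) = jdet K * (ref_normal d s \<bullet> z)"
  unfolding edge_normal_def
  by (simp add: dot_lmul_matrix jac_inverse[OF assms])

lemma line_pt_affine: "line_pt d a b = line_pt d a 0 + b *\<^sub>R (line_pt d a 1 - line_pt d a 0)"
  by (simp add: line_pt_def vec_eq_iff)

text \<open>The normal is the edge vector turned by a right angle, up to orientation.\<close>

lemma edge_normal_rotation:
  assumes K: "jdet K > 0" and \<tau>: "\<tau> = elem_map K (line_pt d s 1) - elem_map K (line_pt d s 0)"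
  shows "\<exists>c\<in>{1, -1}. edge_normal (K, d, s) = c *\<^sub>R vector [\<tau> $ 2, - \<tau> $ 1]"
proof -
  let ?A = "jac K" and ?n = "edge_normal (K, d, s)" and ?N = "ref_normal d s"
  have "?n $ 1 * ?A $ 1 $ 1 + ?n $ 2 * ?A $ 2 $ 1 = jdet K * ?N $ 1"
    "?n $ 1 * ?A $ 1 $ 2 + ?n $ 2 * ?A $ 2 $ 2 = jdet K * ?N $ 2"
    using edge_normal_inner[OF K, of d s "axis 1 1"] edge_normal_inner[OF K, of d s "axis 2 1"]
    by (simp_all add: inner_vec_def sum_2 matrix_vector_mult_def axis_def)
  then have "jdet K * ?n $ 1 = jdet K * (?N $ 1 * ?A $ 2 $ 2 - ?N $ 2 * ?A $ 2 $ 1)"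
    "jdet K * ?n $ 2 = jdet K * (?N $ 2 * ?A $ 1 $ 1 - ?N $ 1 * ?A $ 1 $ 2)"
    unfolding det_2 by algebra+
  then have n: "?n $ 1 = ?N $ 1 * ?A $ 2 $ 2 - ?N $ 2 * ?A $ 2 $ 1"
    "?n $ 2 = ?N $ 2 * ?A $ 1 $ 1 - ?N $ 1 * ?A $ 1 $ 2"
    using K by simp_all
  have \<tau>': "\<tau> = ?A *v (line_pt d s 1 - line_pt d s 0)" unfolding \<tau> elem_map_diff ..
  \<comment> \<open>The reference tangents in direction 2 (for \<open>d = 1\<close>) and in direction 1 (for \<open>d = 2\<close>) turn to
    opposite sides.\<close>
  define c :: real where "c = (if (d = 1) = (s = 1) then 1 else - 1)"
  consider "d = 1" | "d = 2" using exhaust_2 by blast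
  then have "?n = c *\<^sub>R vector [\<tau> $ 2, - \<tau> $ 1]"
    by cases (use n in \<open>simp_all add: vec_eq_iff forall_2 \<tau>' matrix_vector_mult_def sum_2
        line_pt_def ref_normal_def axis_def c_def split: if_splits\<close>)
  then show ?thesis by (intro bexI[of _ c]) (auto simp: c_def)
qed

lemma edge_normal_nonzero:
  assumes "jdet K > 0"
  shows "edge_normal (K, d, s) \<noteq> 0"
proof
  assume "edge_normal (K, d, s) = 0"
  then have "ref_normal d s \<bullet> axis d 1 = 0"
    using edge_normal_inner[OF assms, of d s "axis d 1"] assms by simp
  then show False by (simp add: ref_normal_inner axis_def split: if_splits)
qed

lemma ref_edge_eq:
  assumes "s \<in> {0, 1}"
  shows "ref_edge d s = line_pt d s ` {0..1}"
proof (rule set_eqI)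
  fix x :: "real^2"
  define d' :: 2 where "d' = (if d = 1 then 2 else 1)"
  have d': "i = d \<or> i = d'" "d' \<noteq> d" for i
    using exhaust_2[of d] exhaust_2[of i] by (auto simp: d'_def)
  show "x \<in> ref_edge d s \<longleftrightarrow> x \<in> line_pt d s ` {0..1}"
  proof
    assume "x \<in> ref_edge d s"
    then have "x $ d = s" "0 \<le> x $ d'" "x $ d' \<le> 1"
      by (auto simp: ref_edge_def mem_box_cart)
    then show "x \<in> line_pt d s ` {0..1}"
      using d'(1) by (intro image_eqI[of _ _ "x $ d'"]) (auto simp: line_pt_def vec_eq_iff)
  next
    assume "x \<in> line_pt d s ` {0..1}"
    then show "x \<in> ref_edge d s"
      using assms by (auto simp: ref_edge_def mem_box_cart line_pt_def)
  qed
qed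

lemma elem_map_line_pt:
  "elem_map K (line_pt d s a)
    = (1 - a) *\<^sub>R elem_map K (line_pt d s 0) + a *\<^sub>R elem_map K (line_pt d s 1)"
proof -
  have "elem_map K (line_pt d s a) - elem_map K (line_pt d s 0)
      = a *\<^sub>R (elem_map K (line_pt d s 1) - elem_map K (line_pt d s 0))"
    unfolding elem_map_diff matrix_vector_mult_scaleR[symmetric]
    by (subst line_pt_affine) simp
  then show ?thesis by (simp add: algebra_simps)
qed

lemma edge_set_eq_closed_segment:
  assumes "s \<in> {0, 1}"
  shows "edge_set (K, d, s) = closed_segment (elem_map K (line_pt d s 0)) (elem_map K (line_pt d s 1))"
  unfolding edge_set_def closed_segment_image_interval split ref_edge_eq[OF assms] image_image
  by (intro image_cong refl elem_map_line_pt)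

lemma elem_map_interior:
  assumes K: "jdet K > 0" and x: "x \<in> box 0 1"
  shows "elem_map K x \<in> interior (elem_set K)"
proof (rule interiorI)
  let ?g = "\<lambda>z. matrix_inv (jac K) *v (z - snd K)"
  show "open (?g -` box 0 1)"
    by (intro open_vimage open_box linear_continuous_on_compose[OF _ matrix_vector_mul_linear]
        continuous_intros)
  show "elem_map K x \<in> ?g -` box 0 1"
    using x by (simp add: elem_map_def jac_inverse[OF K])
  show "?g -` box 0 1 \<subseteq> elem_set K"
  proof
    fix z assume "z \<in> ?g -` box 0 1"
    then have "?g z \<in> cbox 0 1" using box_subset_cbox by auto
    moreover have "z = elem_map K (?g z)" by (simp add: elem_map_def jac_inverse[OF K])
    ultimately show "z \<in> elem_set K" unfolding elem_set_def by blast
  qed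
qed

lemma elem_set_half_plane:
  assumes K: "jdet K > 0" and s: "s \<in> {0, 1}" and z: "z \<in> elem_set K"
  shows "edge_normal (K, d, s) \<bullet> (z - elem_map K (line_pt d s a)) \<le> 0"
proof -
  obtain x where x: "x \<in> cbox 0 1" "z = elem_map K x" using z unfolding elem_set_def by blast
  have "ref_normal d s \<bullet> (x - line_pt d s a) \<le> 0"
    using x(1) s by (auto simp: ref_normal_inner line_pt_nth mem_box_cart)
  then show ?thesis
    unfolding x(2) elem_map_diff edge_normal_inner[OF K] using K
    by (simp add: mult_nonneg_nonpos)
qed

lemma edge_midpoint_interior:
  assumes K: "jdet K > 0" and s: "s \<in> {0, 1}"
  shows "\<exists>\<delta>>0. \<forall>\<epsilon>. 0 < \<epsilon> \<and> \<epsilon> < \<delta> \<longrightarrow>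
    elem_map K (line_pt d s (1/2)) - \<epsilon> *\<^sub>R edge_normal (K, d, s) \<in> interior (elem_set K)"
proof -
  let ?n = "edge_normal (K, d, s)"
  define h where "h = matrix_inv (jac K) *v ?n"
  have h: "jac K *v h = ?n" by (simp add: h_def jac_inverse[OF K])
  have "0 < ?n \<bullet> ?n" using edge_normal_nonzero[OF K] by simp
  then have Nh: "0 < ref_normal d s \<bullet> h"
    using edge_normal_inner[OF K, of d s h] K unfolding h by (metis zero_less_mult_pos)
  define \<delta> where "\<delta> = 1 / (2 * (1 + norm h))"
  have "0 < \<delta>" by (simp add: \<delta>_def add_pos_nonneg)
  moreover have "elem_map K (line_pt d s (1/2)) - \<epsilon> *\<^sub>R ?n \<in> interior (elem_set K)"
    if \<epsilon>: "0 < \<epsilon>" "\<epsilon> < \<delta>" for \<epsilon>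
  proof -
    have small: "\<bar>\<epsilon> * h $ i\<bar> < 1/2" for i
    proof -
      have "\<bar>\<epsilon> * h $ i\<bar> \<le> \<epsilon> * (1 + norm h)"
        using \<epsilon> component_le_norm_cart[of h i] by (simp add: abs_mult mult_left_mono)
      also have "\<dots> < \<delta> * (1 + norm h)" using \<epsilon>
        by (intro mult_strict_right_mono) (auto simp: add_pos_nonneg)
      also have "\<dots> = 1/2"
        using add_pos_nonneg[OF zero_less_one norm_ge_zero[of h]] by (simp add: \<delta>_def)
      finally show ?thesis .
    qed
    have "line_pt d s (1/2) - \<epsilon> *\<^sub>R h \<in> box 0 1"
      unfolding mem_box_cart
    proof
      fix i
      show "(0::real^2) $ i < (line_pt d s (1/2) - \<epsilon> *\<^sub>R h) $ i
        \<and> (line_pt d s (1/2) - \<epsilon> *\<^sub>R h) $ i < (1::real^2) $ i"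
      proof (cases "i = d")
        case True
        have "s = 1 \<and> 0 < \<epsilon> * h $ d \<or> s = 0 \<and> \<epsilon> * h $ d < 0"
          using Nh s \<epsilon> by (auto simp: ref_normal_inner mult_pos_neg)
        then show ?thesis using small[of d] True by (auto simp: line_pt_nth)
      next
        case False
        then show ?thesis using small[of i] by (auto simp: line_pt_nth abs_less_iff)
      qed
    qed
    from elem_map_interior[OF K this]
    have "elem_map K (line_pt d s (1/2) - \<epsilon> *\<^sub>R h) \<in> interior (elem_set K)" .
    moreover have "elem_map K (line_pt d s (1/2) - \<epsilon> *\<^sub>R h) = elem_map K (line_pt d s (1/2)) - \<epsilon> *\<^sub>R ?n"
      by (simp add: elem_map_def matrix_vector_mult_diff_distrib matrix_vector_mult_scaleR h)
    ultimately show ?thesis by simp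
  qed
  ultimately show ?thesis by blast
qed

text \<open>Two elements with a common edge and disjoint interiors have opposite normals there, for with
  equal normals both would contain the points slightly inside of the midpoint of the edge. The
  affine parametrisations of the edge agree up to orientation.\<close>

lemma shared_edge:
  assumes K: "jdet K > 0" "jdet K' > 0" and s: "s \<in> {0, 1}" "s' \<in> {0, 1}"
    and eq: "edge_set (K, d, s) = edge_set (K', d', s')"
    and disj: "interior (elem_set K) \<inter> interior (elem_set K') = {}"
  shows "edge_normal (K', d', s') = - edge_normal (K, d, s)"
    and "(\<forall>a. elem_map K (line_pt d s a) = elem_map K' (line_pt d' s' a)) \<or>
         (\<forall>a. elem_map K (line_pt d s a) = elem_map K' (line_pt d' s' (1 - a)))"
proof -
  let ?P = "\<lambda>a. elem_map K (line_pt d s a)" and ?P' = "\<lambda>a. elem_map K' (line_pt d' s' a)"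
  have ends: "?P 0 = ?P' 0 \<and> ?P 1 = ?P' 1 \<or> ?P 0 = ?P' 1 \<and> ?P 1 = ?P' 0"
    using eq unfolding edge_set_eq_closed_segment[OF s(1)] edge_set_eq_closed_segment[OF s(2)]
    by (simp add: doubleton_eq_iff)
  then show "(\<forall>a. ?P a = ?P' a) \<or> (\<forall>a. ?P a = ?P' (1 - a))"
  proof (elim disjE conjE)
    assume "?P 0 = ?P' 0" "?P 1 = ?P' 1"
    then have "?P a = ?P' a" for a
      by (simp add: elem_map_line_pt[of K d s a] elem_map_line_pt[of K' d' s' a])
    then show ?thesis by blast
  next
    assume "?P 0 = ?P' 1" "?P 1 = ?P' 0"
    then have "?P a = ?P' (1 - a)" for a
      by (simp add: elem_map_line_pt[of K d s a] elem_map_line_pt[of K' d' s' "1 - a"])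
    then show ?thesis by blast
  qed
  then have mid: "?P (1/2) = ?P' (1/2)" by (auto dest: spec[of _ "1/2"])
  obtain c c' where c: "c \<in> {1, -1}" "c' \<in> {1, -1}"
    "edge_normal (K, d, s) = c *\<^sub>R vector [(?P 1 - ?P 0) $ 2, - (?P 1 - ?P 0) $ 1]"
    "edge_normal (K', d', s') = c' *\<^sub>R vector [(?P' 1 - ?P' 0) $ 2, - (?P' 1 - ?P' 0) $ 1]"
    using edge_normal_rotation[OF K(1) refl] edge_normal_rotation[OF K(2) refl] by metis
  have "edge_normal (K', d', s') = edge_normal (K, d, s)
      \<or> edge_normal (K', d', s') = - edge_normal (K, d, s)"
    using c ends by (auto simp: vec_eq_iff forall_2)
  moreover have "edge_normal (K', d', s') \<noteq> edge_normal (K, d, s)"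
  proof
    assume n: "edge_normal (K', d', s') = edge_normal (K, d, s)"
    obtain \<delta> \<delta>' where \<delta>: "\<delta> > 0" "\<delta>' > 0"
      and i: "\<And>\<epsilon>. 0 < \<epsilon> \<Longrightarrow> \<epsilon> < \<delta> \<Longrightarrow> ?P (1/2) - \<epsilon> *\<^sub>R edge_normal (K, d, s) \<in> interior (elem_set K)"
      and i': "\<And>\<epsilon>. 0 < \<epsilon> \<Longrightarrow> \<epsilon> < \<delta>' \<Longrightarrow> ?P' (1/2) - \<epsilon> *\<^sub>R edge_normal (K', d', s') \<in> interior (elem_set K')"
      using edge_midpoint_interior[OF K(1) s(1)] edge_midpoint_interior[OF K(2) s(2)] by metis
    define \<epsilon> where "\<epsilon> = min \<delta> \<delta>' / 2"
    have "0 < \<epsilon>" "\<epsilon> < \<delta>" "\<epsilon> < \<delta>'" using \<delta> by (auto simp: \<epsilon>_def)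
    then show False using i[of \<epsilon>] i'[of \<epsilon>] disj n mid by auto
  qed
  ultimately show "edge_normal (K', d', s') = - edge_normal (K, d, s)" by blast
qed

lemma edge_set_inject:
  assumes K: "jdet K > 0" and s: "s \<in> {0, 1}" "s' \<in> {0, 1}"
    and a: "0 < a" "a < 1" and mem: "elem_map K (line_pt d s a) \<in> edge_set (K, d', s')"
  shows "d' = d \<and> s' = s"
proof -
  obtain x where "x \<in> ref_edge d' s'" "elem_map K (line_pt d s a) = elem_map K x"
    using mem unfolding edge_set_def by auto
  then have "line_pt d s a $ d' = s'"
    by (simp add: elem_map_inject[OF K] ref_edge_def)
  then show ?thesis using s a by (auto simp: line_pt_def split: if_splits)
qed

text \<open>An edge with a point in the interior of the domain has an element on its other side: points
  just outside of the element, near a relative interior point of the edge, belong to the finite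
  union of the other elements, which is closed.\<close>

lemma interior_edge_shared:
  assumes mesh: "conforming_mesh \<Omega> \<T>" and e: "(K, d, s) \<in> elem_edges \<T>"
    and nb: "(K, d, s) \<notin> boundary_edges \<Omega> \<T>"
  shows "\<exists>e' \<in> elem_edges \<T>. fst e' \<noteq> K \<and> edge_set e' = edge_set (K, d, s)"
proof -
  have fin: "finite \<T>" and det: "\<And>K. K \<in> \<T> \<Longrightarrow> jdet K > 0"
    and \<Omega>: "\<Omega> = (\<Union>K\<in>\<T>. elem_set K)"
    using mesh unfolding conforming_mesh_def by auto
  have K: "K \<in> \<T>" and s: "s \<in> {0, 1}" using e by (auto simp: elem_edges_def)
  let ?n = "edge_normal (K, d, s)" and ?P = "\<lambda>a. elem_map K (line_pt d s a)"
  have closed_elem: "closed (elem_set K)" for K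
  proof -
    have "compact (elem_map K ` cbox 0 1)" unfolding elem_map_def
      by (intro compact_continuous_image continuous_intros compact_cbox)
    then show ?thesis unfolding elem_set_def by (rule compact_imp_closed)
  qed
  have edge_sub: "edge_set (K, d, s) \<subseteq> elem_set K"
    unfolding edge_set_def elem_set_def ref_edge_def by auto
  have "closed \<Omega>" unfolding \<Omega> using fin closed_elem by (intro closed_UN) auto
  moreover obtain z0 where z0: "z0 \<in> edge_set (K, d, s)" "z0 \<notin> frontier \<Omega>"
    using nb e by (auto simp: boundary_edges_def)
  moreover have "z0 \<in> \<Omega>" using z0(1) edge_sub K \<Omega> by blast
  ultimately have "z0 \<in> interior \<Omega>" by (simp add: frontier_def)
  moreover obtain a0 where a0: "a0 \<in> {0..1}" "z0 = ?P a0"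
    using z0(1) ref_edge_eq[OF s] unfolding edge_set_def by auto
  \<comment> \<open>The edge point may be moved into the relative interior of the edge.\<close>
  ultimately have "a0 \<in> closure {0<..<1} \<inter> ?P -` interior \<Omega>" by simp
  moreover have "open (?P -` interior \<Omega>)"
  proof (intro open_vimage open_interior)
    have "?P = (\<lambda>a. (1 - a) *\<^sub>R ?P 0 + a *\<^sub>R ?P 1)" by (rule ext) (rule elem_map_line_pt)
    then show "continuous_on UNIV ?P" by (rule ssubst) (intro continuous_intros)
  qed
  ultimately have "(?P -` interior \<Omega>) \<inter> {0<..<1} \<noteq> {}"
    using open_Int_closure_eq_empty[of "?P -` interior \<Omega>" "{0<..<1}"] by (metis Int_iff empty_iff)
  then obtain a where a: "0 < a" "a < 1" "?P a \<in> interior \<Omega>" by auto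
  define R where "R = (\<Union>K'\<in>\<T> - {K}. elem_set K')"
  have "closed R" unfolding R_def using fin closed_elem by (intro closed_UN) auto
  have "\<forall>\<^sub>F \<epsilon> in at_right 0. ?P a + \<epsilon> *\<^sub>R ?n \<in> R"
  proof -
    have "((\<lambda>\<epsilon>. ?P a + \<epsilon> *\<^sub>R ?n) \<longlongrightarrow> ?P a + 0 *\<^sub>R ?n) (at_right 0)"
      by (intro tendsto_intros)
    then have "\<forall>\<^sub>F \<epsilon> in at_right 0. ?P a + \<epsilon> *\<^sub>R ?n \<in> interior \<Omega>"
      using a(3) by (intro topological_tendstoD[of _ "?P a"]) auto
    moreover have "\<forall>\<^sub>F \<epsilon> :: real in at_right 0. \<epsilon> > 0"
      by (simp add: eventually_at_right_less)
    ultimately show ?thesis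
    proof eventually_elim
      case (elim \<epsilon>)
      have "?P a + \<epsilon> *\<^sub>R ?n \<notin> elem_set K"
      proof
        assume "?P a + \<epsilon> *\<^sub>R ?n \<in> elem_set K"
        from elem_set_half_plane[OF det[OF K] s this, of d a]
        have "\<epsilon> * (?n \<bullet> ?n) \<le> 0" by simp
        moreover have "0 < ?n \<bullet> ?n" using edge_normal_nonzero[OF det[OF K]] by simp
        ultimately show False using elim(2) by (simp add: mult_le_0_iff)
      qed
      then show ?case using elim(1) interior_subset[of \<Omega>] unfolding R_def \<Omega> by blast
    qed
  qed
  moreover have "((\<lambda>\<epsilon>. ?P a + \<epsilon> *\<^sub>R ?n) \<longlongrightarrow> ?P a + 0 *\<^sub>R ?n) (at_right 0)"
    by (intro tendsto_intros)
  ultimately have "?P a + 0 *\<^sub>R ?n \<in> R"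
    using \<open>closed R\<close> by (intro Lim_in_closed_set[of R _ "at_right 0"]) auto
  then obtain K' where K': "K' \<in> \<T>" "K' \<noteq> K" "?P a \<in> elem_set K'" unfolding R_def by auto
  have Pe: "?P a \<in> edge_set (K, d, s)"
    unfolding edge_set_def using ref_edge_eq[OF s] a by auto
  have "?P a \<notin> elem_vertices K"
  proof
    assume "?P a \<in> elem_vertices K"
    then have "line_pt d s a $ i \<in> {0, 1}" for i
      unfolding elem_vertices_def using elem_map_inject[OF det[OF K]] by auto
    moreover obtain i :: 2 where "i \<noteq> d" using exhaust_2[of d] by (metis zero_neq_one)
    ultimately have "a \<in> {0, 1}" using line_pt_nth(2)[of i d s a] by metis
    then show False using a by auto
  qed
  moreover have "?P a \<in> elem_set K \<inter> elem_set K'" using Pe edge_sub K'(3) by blast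
  moreover have "elem_set K \<inter> elem_set K' = {} \<or>
      (\<exists>x \<in> elem_vertices K \<inter> elem_vertices K'. elem_set K \<inter> elem_set K' = {x}) \<or>
      (\<exists>e \<in> elem_edges {K}. \<exists>e' \<in> elem_edges {K'}.
          elem_set K \<inter> elem_set K' = edge_set e \<and> edge_set e = edge_set e')"
    using mesh K K'(1,2) unfolding conforming_mesh_def by metis
  ultimately have "\<exists>e \<in> elem_edges {K}. \<exists>e' \<in> elem_edges {K'}.
      elem_set K \<inter> elem_set K' = edge_set e \<and> edge_set e = edge_set e'"
    by (metis IntD1 emptyE singletonD)
  then obtain e1 e' where e1: "e1 \<in> elem_edges {K}" and e': "e' \<in> elem_edges {K'}"
    and int: "elem_set K \<inter> elem_set K' = edge_set e1" "edge_set e1 = edge_set e'"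
    by blast
  obtain d1 s1 where d1: "e1 = (K, d1, s1)" "s1 \<in> {0, 1}" using e1 by (auto simp: elem_edges_def)
  have "?P a \<in> edge_set (K, d1, s1)" using int(1) Pe edge_sub K'(3) d1 by blast
  then have "e1 = (K, d, s)" using edge_set_inject[OF det[OF K] s d1(2) a(1,2)] d1 by blast
  then show ?thesis using e' int(2) K' by (intro bexI[of _ e']) (auto simp: elem_edges_def)
qed

text \<open>Edges of three different elements cannot coincide, since the normals of any two of them would
  be opposite, and the edges of a single element are pairwise different.\<close>

lemma shared_edge_unique:
  assumes mesh: "conforming_mesh \<Omega> \<T>"
    and e: "e \<in> elem_edges \<T>" "e1 \<in> elem_edges \<T>" "e2 \<in> elem_edges \<T>"
    and ne: "fst e1 \<noteq> fst e" "fst e2 \<noteq> fst e"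
    and eq: "edge_set e1 = edge_set e" "edge_set e2 = edge_set e"
  shows "e1 = e2"
proof -
  obtain K d s K1 d1 s1 K2 d2 s2 where es: "e = (K, d, s)" "e1 = (K1, d1, s1)" "e2 = (K2, d2, s2)"
    by (metis prod_cases3)
  have det: "jdet K > 0" "jdet K1 > 0" "jdet K2 > 0" and s: "s \<in> {0,1}" "s1 \<in> {0,1}" "s2 \<in> {0,1}"
    using mesh e es unfolding conforming_mesh_def elem_edges_def by auto
  have opp: "edge_normal b = - edge_normal a"
    if ab: "a \<in> elem_edges \<T>" "b \<in> elem_edges \<T>" "fst a \<noteq> fst b" "edge_set a = edge_set b" for a b
  proof -
    obtain Ka da sa Kb db sb where "a = (Ka, da, sa)" "b = (Kb, db, sb)" by (metis prod_cases3)
    moreover from this ab have "Ka \<in> \<T>" "Kb \<in> \<T>" "Ka \<noteq> Kb" "sa \<in> {0, 1}" "sb \<in> {0, 1}"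
      by (auto simp: elem_edges_def)
    moreover from this mesh have "jdet Ka > 0" "jdet Kb > 0"
      "interior (elem_set Ka) \<inter> interior (elem_set Kb) = {}"
      unfolding conforming_mesh_def by blast+
    ultimately show ?thesis using ab(4) by (simp only: shared_edge(1))
  qed
  have "K1 = K2"
  proof (rule ccontr)
    assume "K1 \<noteq> K2"
    then have "edge_normal e2 = - edge_normal e1" "edge_normal e1 = - edge_normal e"
      "edge_normal e2 = - edge_normal e"
      using opp e ne eq es by (metis fst_conv)+
    then have "edge_normal e = - edge_normal e" by simp
    then have "edge_normal e = 0" by (simp add: vec_eq_iff)
    then show False using edge_normal_nonzero[OF det(1)] es by simp
  qed
  moreover have "elem_map K1 (line_pt d1 s1 (1/2)) \<in> edge_set (K1, d2, s2)"
  proof -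
    have "elem_map K1 (line_pt d1 s1 (1/2)) \<in> edge_set (K1, d1, s1)"
      unfolding edge_set_def using ref_edge_eq[OF s(2)] by auto
    then show ?thesis using eq es \<open>K1 = K2\<close> by simp
  qed
  ultimately show ?thesis using edge_set_inject[OF det(2) s(2,3), of "1/2" d1 d2] es by simp
qed

section \<open>The total entropy outflow through the edges\<close>

text \<open>The entropy outflow of an element through one of its edges: the entropy flux above, integrated
  over the reference edge with the nodal quadrature rule.\<close>

definition edge_outflow ::
  "nat \<Rightarrow> (nat \<Rightarrow> real) \<Rightarrow> (nat \<Rightarrow> real) \<Rightarrow> (real^'c \<Rightarrow> real^'c) \<Rightarrow>
   (2 \<Rightarrow> real^'c \<Rightarrow> real^'c) \<Rightarrow> (2 \<Rightarrow> real^'c \<Rightarrow> real) \<Rightarrow>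
   (real^'c \<Rightarrow> real^'c \<Rightarrow> real^2 \<Rightarrow> real^'c) \<Rightarrow> (elem \<Rightarrow> real^2 \<Rightarrow> real^'c) \<Rightarrow>
   (elem_edge \<Rightarrow> real^2 \<Rightarrow> real^'c) \<Rightarrow> elem_edge \<Rightarrow> real" where
  "edge_outflow p \<xi> \<omega> v f F fhat uh up = (\<lambda>(K, d, s).
     \<Sum>k\<le>p. \<omega> k * edge_entropy_flux v f F fhat uh up (K, d, s) (line_pt d s (\<xi> k)))"

lemma edge_entropy_flux_pair_nonneg:
  assumes es: "entropy_stable_flux D v f F fhat"
    and n: "edge_normal e \<noteq> 0" "edge_normal e' = - edge_normal e"
    and D: "uh (fst e) x \<in> D" "uh (fst e') x' \<in> D"
    and up: "up e x = uh (fst e') x'" "up e' x' = uh (fst e) x"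
  shows "0 \<le> edge_entropy_flux v f F fhat uh up e x + edge_entropy_flux v f F fhat uh up e' x'"
proof -
  let ?n = "edge_normal e" and ?L = "uh (fst e) x" and ?R = "uh (fst e') x'"
  let ?\<psi> = "flux_potential v f F"
  have "fhat ?L ?R ?n = - fhat ?R ?L (- ?n)"
    and "(v ?R - v ?L) \<bullet> fhat ?L ?R ?n \<le> (\<Sum>j\<in>UNIV. ?n $ j * (?\<psi> j ?R - ?\<psi> j ?L))"
    using es n(1) D unfolding entropy_stable_flux_def by blast+
  then show ?thesis
    by (simp add: edge_entropy_flux_def up n(2) inner_diff_left inner_minus_right sum_negf
        right_diff_distrib sum_subtractf)
qed

text \<open>What leaves two neighbours through their common edge adds up to the entropy dissipated by the
  interface flux, which is nonnegative. A translation \<open>\<tau>\<close> accounts for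
  edges identified periodically; since the Gauss--Lobatto rule is symmetric, its nodes on both
  sides match even if the two parametrisations of the edge have opposite orientations.\<close>

lemma edge_outflow_pair_nonneg:
  assumes gl: "gauss_lobatto (p + 1) \<xi> \<omega>" and es: "entropy_stable_flux D v f F fhat"
    and K: "jdet K > 0" "jdet K' > 0" and s: "s \<in> {0, 1}" "s' \<in> {0, 1}"
    and edge: "(\<lambda>x. x + \<tau>) ` edge_set (K, d, s) = edge_set (K', d', s')"
    and disj: "interior ((\<lambda>x. x + \<tau>) ` elem_set K) \<inter> interior (elem_set K') = {}"
    and up: "\<And>x x'. x \<in> ref_edge d s \<Longrightarrow> x' \<in> ref_edge d' s' \<Longrightarrow>
        elem_map K x + \<tau> = elem_map K' x' \<Longrightarrow>
        up (K, d, s) x = uh K' x' \<and> up (K', d', s') x' = uh K x"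
    and D: "\<And>k. k \<le> p \<Longrightarrow> uh K (line_pt d s (\<xi> k)) \<in> D"
        "\<And>k. k \<le> p \<Longrightarrow> uh K' (line_pt d' s' (\<xi> k)) \<in> D"
  shows "0 \<le> edge_outflow p \<xi> \<omega> v f F fhat uh up (K, d, s)
    + edge_outflow p \<xi> \<omega> v f F fhat uh up (K', d', s')"
proof -
  \<comment> \<open>The translated element shares the edge with \<open>K'\<close> and has the same normals as \<open>K\<close>.\<close>
  define L :: elem where "L = (jac K, snd K + \<tau>)"
  have L: "elem_map L x = elem_map K x + \<tau>" for x by (simp add: L_def elem_map_def add.assoc)
  have L_set: "elem_set L = (\<lambda>x. x + \<tau>) ` elem_set K"
    by (simp add: elem_set_def L image_image)
  have L_edge: "edge_set (L, d, s) = edge_set (K', d', s')"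
    unfolding edge[symmetric] by (simp add: edge_set_def L image_image)
  have L_normal: "edge_normal (L, d, s) = edge_normal (K, d, s)"
    by (simp add: edge_normal_def L_def)
  have L_det: "jdet L > 0" using K by (simp add: L_def)
  have L_disj: "interior (elem_set L) \<inter> interior (elem_set K') = {}"
    using disj by (simp add: L_set)
  note shared = shared_edge[OF L_det K(2) s L_edge L_disj, unfolded L L_normal]
  obtain \<sigma> where \<sigma>: "\<And>k. k \<le> p \<Longrightarrow> \<sigma> k \<le> p" "\<And>k. k \<le> p \<Longrightarrow> \<sigma> (\<sigma> k) = k"
    "\<And>k. k \<le> p \<Longrightarrow> \<omega> (\<sigma> k) = \<omega> k"
    "\<And>k. k \<le> p \<Longrightarrow> elem_map K (line_pt d s (\<xi> k)) + \<tau> = elem_map K' (line_pt d' s' (\<xi> (\<sigma> k)))"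
    using shared(2)
  proof
    assume "\<forall>a. elem_map K (line_pt d s a) + \<tau> = elem_map K' (line_pt d' s' a)"
    then show thesis by (intro that[of "\<lambda>k. k"]) auto
  next
    assume "\<forall>a. elem_map K (line_pt d s a) + \<tau> = elem_map K' (line_pt d' s' (1 - a))"
    then show thesis
      using gauss_lobatto_symmetric[OF gl] by (intro that[of "\<lambda>k. p - k"]) auto
  qed
  let ?e = "(K, d, s)" and ?e' = "(K', d', s')"
  let ?B = "edge_entropy_flux v f F fhat uh up"
  have "edge_outflow p \<xi> \<omega> v f F fhat uh up ?e' = (\<Sum>k\<le>p. \<omega> k * ?B ?e' (line_pt d' s' (\<xi> k)))"
    by (simp add: edge_outflow_def)
  also have "\<dots> = (\<Sum>k\<le>p. \<omega> k * ?B ?e' (line_pt d' s' (\<xi> (\<sigma> k))))"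
    by (rule sum.reindex_bij_witness[of _ \<sigma> \<sigma>]) (use \<sigma> in auto)
  finally have "edge_outflow p \<xi> \<omega> v f F fhat uh up ?e + edge_outflow p \<xi> \<omega> v f F fhat uh up ?e'
      = (\<Sum>k\<le>p. \<omega> k * (?B ?e (line_pt d s (\<xi> k)) + ?B ?e' (line_pt d' s' (\<xi> (\<sigma> k)))))"
    by (simp add: edge_outflow_def sum.distrib distrib_left)
  also have "0 \<le> \<dots>"
  proof (rule sum_nonneg)
    fix k assume "k \<in> {..p}"
    then have k: "k \<le> p" by simp
    have "line_pt d s (\<xi> k) \<in> ref_edge d s" "line_pt d' s' (\<xi> (\<sigma> k)) \<in> ref_edge d' s'"
      unfolding ref_edge_eq[OF s(1)] ref_edge_eq[OF s(2)]
      using gauss_lobatto_node_bounds(1,2)[OF gl, of k]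
        gauss_lobatto_node_bounds(1,2)[OF gl, of "\<sigma> k"] k \<sigma>(1)[OF k] by auto
    from up[OF this \<sigma>(4)[OF k]] have "0 \<le> ?B ?e (line_pt d s (\<xi> k)) + ?B ?e' (line_pt d' s' (\<xi> (\<sigma> k)))"
      using D(1)[OF k] D(2)[OF \<sigma>(1)[OF k]] edge_normal_nonzero[OF K(1)] shared(1)
      by (intro edge_entropy_flux_pair_nonneg[OF es]) auto
    then show "0 \<le> \<omega> k * (?B ?e (line_pt d s (\<xi> k)) + ?B ?e' (line_pt d' s' (\<xi> (\<sigma> k))))"
      using gauss_lobatto_weight_pos[OF gl, of k] k by simp
  qed
  finally show ?thesis .
qed

lemma sum_nonneg_involution:
  fixes B :: "'a \<Rightarrow> real"
  assumes "\<And>e. e \<in> S \<Longrightarrow> \<pi> e \<in> S" "\<And>e. e \<in> S \<Longrightarrow> \<pi> (\<pi> e) = e"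
    and "\<And>e. e \<in> S \<Longrightarrow> 0 \<le> B e + B (\<pi> e)"
  shows "0 \<le> (\<Sum>e\<in>S. B e)"
proof -
  have "(\<Sum>e\<in>S. B (\<pi> e)) = (\<Sum>e\<in>S. B e)"
    by (rule sum.reindex_bij_witness[of _ \<pi> \<pi>]) (use assms in auto)
  moreover have "0 \<le> (\<Sum>e\<in>S. B e + B (\<pi> e))" using assms by (intro sum_nonneg) auto
  ultimately show ?thesis by (simp add: sum.distrib)
qed

text \<open>The summation pairs each edge with the unique edge of another element that coincides with it.\<close>

lemma interior_edges_outflow_nonneg:
  assumes gl: "gauss_lobatto (p + 1) \<xi> \<omega>" and es: "entropy_stable_flux D v f F fhat"
    and mesh: "conforming_mesh \<Omega> \<T>"
    and D: "\<And>K d s k. K \<in> \<T> \<Longrightarrow> s \<in> {0, 1} \<Longrightarrow> k \<le> p \<Longrightarrow> uh K (line_pt d s (\<xi> k)) \<in> D"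
    and nb: "neighbor_traces \<T> uh up"
  shows "0 \<le> (\<Sum>e\<in>elem_edges \<T> - boundary_edges \<Omega> \<T>. edge_outflow p \<xi> \<omega> v f F fhat uh up e)"
proof -
  let ?S = "elem_edges \<T> - boundary_edges \<Omega> \<T>"
  define opp where
    "opp = (\<lambda>e e'. e' \<in> elem_edges \<T> \<and> fst e' \<noteq> fst e \<and> edge_set e' = edge_set e)"
  define \<pi> where "\<pi> = (\<lambda>e. SOME e'. opp e e')"
  have opp: "opp e (\<pi> e)" if "e \<in> ?S" for e
  proof -
    have "\<exists>e'. opp e e'"
      using interior_edge_shared[OF mesh, of "fst e" "fst (snd e)" "snd (snd e)"] that
      unfolding opp_def prod.collapse by blast
    then show ?thesis unfolding \<pi>_def by (rule someI_ex)
  qed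
  have in_S: "\<pi> e \<in> ?S" if "e \<in> ?S" for e
    using opp[OF that] that unfolding opp_def boundary_edges_def by auto
  show ?thesis
  proof (rule sum_nonneg_involution[of _ \<pi>])
    fix e assume e: "e \<in> ?S"
    show "\<pi> e \<in> ?S" using in_S[OF e] .
    have o: "opp e (\<pi> e)" "opp (\<pi> e) (\<pi> (\<pi> e))" using opp in_S e by blast+
    have "e \<in> elem_edges \<T>" using e by simp
    moreover have "opp (\<pi> e) e" using o(1) e unfolding opp_def by auto
    ultimately show "\<pi> (\<pi> e) = e"
      using o shared_edge_unique[OF mesh, of "\<pi> e" "\<pi> (\<pi> e)" e] unfolding opp_def by blast
    obtain K d s K' d' s' where es': "e = (K, d, s)" "\<pi> e = (K', d', s')" by (metis prod_cases3)
    have "opp e (K', d', s')" using o(1) es'(2) by (simp only:)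
    then have E: "(K, d, s) \<in> elem_edges \<T>" "(K', d', s') \<in> elem_edges \<T>" "K' \<noteq> K"
      "edge_set (K, d, s) = edge_set (K', d', s')"
      using e unfolding opp_def es'(1) fst_conv by simp_all
    then have KT: "K \<in> \<T>" "K' \<in> \<T>" "s \<in> {0, 1}" "s' \<in> {0, 1}" by (auto simp: elem_edges_def)
    have det: "jdet K > 0" "jdet K' > 0"
      and disj: "interior (elem_set K) \<inter> interior (elem_set K') = {}"
      using mesh KT E(3) unfolding conforming_mesh_def by blast+
    have tr: "up (a, b, c) x = uh a' x'"
      if "(a, b, c) \<in> elem_edges \<T>" "(a', b', c') \<in> elem_edges \<T>" "a \<noteq> a'"
        "edge_set (a, b, c) = edge_set (a', b', c')" "x \<in> ref_edge b c" "x' \<in> ref_edge b' c'"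
        "elem_map a x = elem_map a' x'" for a b c a' b' c' x x'
      using nb that unfolding neighbor_traces_def by blast
    have "0 \<le> edge_outflow p \<xi> \<omega> v f F fhat uh up (K, d, s)
        + edge_outflow p \<xi> \<omega> v f F fhat uh up (K', d', s')"
    proof (rule edge_outflow_pair_nonneg[OF gl es det KT(3,4), where \<tau> = 0])
      fix x x' assume x: "x \<in> ref_edge d s" "x' \<in> ref_edge d' s'" "elem_map K x + 0 = elem_map K' x'"
      show "up (K, d, s) x = uh K' x' \<and> up (K', d', s') x' = uh K x"
        using tr[OF E(1,2) E(3)[symmetric] E(4) x(1,2)] tr[OF E(2,1,3) E(4)[symmetric] x(2,1)] x(3) by simp
    qed (use E disj D KT in auto)
    then show "0 \<le> edge_outflow p \<xi> \<omega> v f F fhat uh up e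
        + edge_outflow p \<xi> \<omega> v f F fhat uh up (\<pi> e)"
      unfolding es'(2) unfolding es'(1) .
  qed
qed

lemma periodic_edges_outflow_nonneg:
  assumes gl: "gauss_lobatto (p + 1) \<xi> \<omega>" and es: "entropy_stable_flux D v f F fhat"
    and det: "\<And>K. K \<in> \<T> \<Longrightarrow> jdet K > 0"
    and D: "\<And>K d s k. K \<in> \<T> \<Longrightarrow> s \<in> {0, 1} \<Longrightarrow> k \<le> p \<Longrightarrow> uh K (line_pt d s (\<xi> k)) \<in> D"
    and per: "periodic_identification \<Omega> \<T> per \<tau>"
    and tr: "periodic_traces \<Omega> \<T> per \<tau> uh up"
  shows "0 \<le> (\<Sum>e\<in>boundary_edges \<Omega> \<T>. edge_outflow p \<xi> \<omega> v f F fhat uh up e)"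
proof (rule sum_nonneg_involution[of _ per])
  fix e assume e: "e \<in> boundary_edges \<Omega> \<T>"
  have P: "per e \<in> boundary_edges \<Omega> \<T>" "per (per e) = e" "\<tau> (per e) = - \<tau> e"
    "(\<lambda>x. x + \<tau> e) ` edge_set e = edge_set (per e)"
    "interior ((\<lambda>x. x + \<tau> e) ` elem_set (fst e)) \<inter> interior (elem_set (fst (per e))) = {}"
    using per e unfolding periodic_identification_def by blast+
  show "per e \<in> boundary_edges \<Omega> \<T>" "per (per e) = e" by fact+
  obtain K d s K' d' s' where es': "e = (K, d, s)" "per e = (K', d', s')" by (metis prod_cases3)
  then have KT: "K \<in> \<T>" "K' \<in> \<T>" "s \<in> {0, 1}" "s' \<in> {0, 1}"
    using e P(1) by (auto simp: boundary_edges_def elem_edges_def)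
  have tr': "up (a, b, c) x = uh a' x'"
    if "(a, b, c) \<in> boundary_edges \<Omega> \<T>" "per (a, b, c) = (a', b', c')"
      "x \<in> ref_edge b c" "x' \<in> ref_edge b' c'"
      "elem_map a x + \<tau> (a, b, c) = elem_map a' x'" for a b c a' b' c' x x'
    using tr that unfolding periodic_traces_def by blast
  have "0 \<le> edge_outflow p \<xi> \<omega> v f F fhat uh up (K, d, s)
      + edge_outflow p \<xi> \<omega> v f F fhat uh up (K', d', s')"
  proof (rule edge_outflow_pair_nonneg[OF gl es det[OF KT(1)] det[OF KT(2)] KT(3,4),
        where \<tau> = "\<tau> e"])
    fix x x' assume x: "x \<in> ref_edge d s" "x' \<in> ref_edge d' s'" "elem_map K x + \<tau> e = elem_map K' x'"
    have "elem_map K' x' + \<tau> (K', d', s') = elem_map K x"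
      using P(3) x(3)[symmetric] es' by simp
    then show "up (K, d, s) x = uh K' x' \<and> up (K', d', s') x' = uh K x"
      using tr'[of K d s K' d' s' x x'] tr'[of K' d' s' K d s x' x] x P(1,2) e es' by simp
  qed (use P es' D KT in auto)
  then show "0 \<le> edge_outflow p \<xi> \<omega> v f F fhat uh up e
      + edge_outflow p \<xi> \<omega> v f F fhat uh up (per e)"
    unfolding es'(2) unfolding es'(1) .
qed

lemma boundary_contribution_eq:
  "boundary_contribution p \<xi> \<omega> v f F fhat \<Omega> \<T> uh up
    = (\<Sum>e\<in>boundary_edges \<Omega> \<T>. edge_outflow p \<xi> \<omega> v f F fhat uh up e)"
  unfolding boundary_contribution_def edge_outflow_def edge_entropy_flux_def Let_def
  by (auto intro!: sum.cong)

lemma total_outflow_nonneg: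
  assumes gl: "gauss_lobatto (p + 1) \<xi> \<omega>" and es: "entropy_stable_flux D v f F fhat"
    and mesh: "conforming_mesh \<Omega> \<T>"
    and D: "\<And>K d s k. K \<in> \<T> \<Longrightarrow> s \<in> {0, 1} \<Longrightarrow> k \<le> p \<Longrightarrow> uh K (line_pt d s (\<xi> k)) \<in> D"
    and nb: "neighbor_traces \<T> uh up"
    and bc: "(\<exists>per \<tau>. periodic_identification \<Omega> \<T> per \<tau> \<and> periodic_traces \<Omega> \<T> per \<tau> uh up) \<or>
      boundary_contribution p \<xi> \<omega> v f F fhat \<Omega> \<T> uh up = 0"
  shows "0 \<le> (\<Sum>e\<in>elem_edges \<T>. edge_outflow p \<xi> \<omega> v f F fhat uh up e)"
proof -
  let ?B = "edge_outflow p \<xi> \<omega> v f F fhat uh up"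
  have fin: "finite (elem_edges \<T>)" and det: "\<And>K. K \<in> \<T> \<Longrightarrow> jdet K > 0"
    using mesh by (auto simp: conforming_mesh_def elem_edges_def)
  have sub: "boundary_edges \<Omega> \<T> \<subseteq> elem_edges \<T>" by (auto simp: boundary_edges_def)
  have "0 \<le> (\<Sum>e\<in>boundary_edges \<Omega> \<T>. ?B e)"
    using bc
  proof (elim disjE exE conjE)
    fix per \<tau> assume "periodic_identification \<Omega> \<T> per \<tau>" "periodic_traces \<Omega> \<T> per \<tau> uh up"
    then show ?thesis
      by (intro periodic_edges_outflow_nonneg[where D = D and per = per and \<tau> = \<tau>] gl es det D)
  qed (simp add: boundary_contribution_eq)
  moreover have "0 \<le> (\<Sum>e\<in>elem_edges \<T> - boundary_edges \<Omega> \<T>. ?B e)"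
    by (rule interior_edges_outflow_nonneg[OF gl es mesh D nb])
  ultimately show ?thesis using sum.subset_diff[OF sub fin, of ?B] by simp
qed

section \<open>The entropy balance on one element\<close>

lemma nodal_poly_add:
  "nodal_poly p \<xi> (\<lambda>i j. a i j + b i j) x = nodal_poly p \<xi> a x + nodal_poly p \<xi> b x"
  by (simp add: nodal_poly_def scaleR_add_right sum.distrib)

text \<open>On the left, \<open>h\<close> is the projection of the entropy variables and the nodal polynomial is minus the
  time derivative of the unknown. In direction 1, the mass matrix of direction 2 cancels against
  the factor \<open>M\<^sup>-\<^sup>1 diag(\<omega>)\<close> of \<open>qh\<close>, which reduces the double sum to a weighted sum over the
  lines; likewise with the directions exchanged.\<close>

lemma element_entropy_identity:
  fixes h :: "real^2 \<Rightarrow> real^'c" and uh :: "elem \<Rightarrow> real^2 \<Rightarrow> real^'c"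
  assumes gl: "gauss_lobatto (p + 1) \<xi> \<omega>" "gauss_lobatto \<mu> y w" and "p + 1 \<le> \<mu>"
    and ec: "entropy_conservative_flux D v f F fS"
    and h: "h \<in> tensor_polys p"
    and uD: "\<And>d \<alpha> j. \<alpha> < \<mu> \<Longrightarrow> j \<le> p \<Longrightarrow> uh K (line_pt d (y \<alpha>) (\<xi> j)) \<in> D"
    and vu: "\<And>d \<alpha> j. \<alpha> < \<mu> \<Longrightarrow> j \<le> p \<Longrightarrow>
        v (uh K (line_pt d (y \<alpha>) (\<xi> j))) = h (line_pt d (y \<alpha>) (\<xi> j))"
    and q: "\<And>i j. i \<le> p \<Longrightarrow> j \<le> p \<Longrightarrow> (\<Sum>k\<le>p. mass_matrix p \<mu> \<xi> y w i k *\<^sub>R q k j) =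
        line_rhs p \<mu> \<xi> y w f fS fhat K (uh K) up 1 i j"
    and r: "\<And>i j. i \<le> p \<Longrightarrow> j \<le> p \<Longrightarrow> (\<Sum>k\<le>p. mass_matrix p \<mu> \<xi> y w j k *\<^sub>R r i k) =
        line_rhs p \<mu> \<xi> y w f fS fhat K (uh K) up 2 j i"
    and qh: "\<And>i j. i \<le> p \<Longrightarrow> j \<le> p \<Longrightarrow>
        qh i j = (\<Sum>k\<le>p. node_projection p \<mu> \<xi> \<omega> y w j k *\<^sub>R q i k)"
    and rh: "\<And>i j. i \<le> p \<Longrightarrow> j \<le> p \<Longrightarrow>
        rh i j = (\<Sum>k\<le>p. node_projection p \<mu> \<xi> \<omega> y w i k *\<^sub>R r k j)"
  shows "(\<Sum>\<alpha><\<mu>. \<Sum>\<beta><\<mu>. w \<alpha> * w \<beta> * (h (vector [y \<alpha>, y \<beta>]) \<bullet>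
        nodal_poly p \<xi> (\<lambda>i j. qh i j + rh i j) (vector [y \<alpha>, y \<beta>])))
    = (\<Sum>d\<in>UNIV. \<Sum>s\<in>{0,1}. edge_outflow p \<xi> \<omega> v f F fhat uh up (K, d, s))"
proof -
  let ?M = "mass_matrix p \<mu> \<xi> y w"
  let ?rhs = "line_rhs p \<mu> \<xi> y w f fS fhat K (uh K) up"
  note inj = gauss_lobattoD(2)[OF gl(1)]
  note proj = mass_matrix_node_projection[OF gl assms(3)]
  have line: "(\<Sum>j\<le>p. \<omega> j * (\<Sum>i\<le>p. h (line_pt d (\<xi> i) (\<xi> j)) \<bullet> ?rhs d i j))
      = (\<Sum>s\<in>{0,1}. edge_outflow p \<xi> \<omega> v f F fhat uh up (K, d, s))" for d
  proof -
    have "(\<Sum>j\<le>p. \<omega> j * (\<Sum>i\<le>p. h (line_pt d (\<xi> i) (\<xi> j)) \<bullet> ?rhs d i j))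
        = (\<Sum>j\<le>p. \<omega> j * (\<Sum>s\<in>{0,1}. edge_entropy_flux v f F fhat uh up (K, d, s) (line_pt d s (\<xi> j))))"
      by (intro sum.cong refl arg_cong[where f = "(*) _"] line_entropy_identity[OF gl ec h])
        (use uD vu in auto)
    then show ?thesis
      by (simp add: edge_outflow_def distrib_left sum.distrib)
  qed
  have qpart: "(\<Sum>\<alpha><\<mu>. \<Sum>\<beta><\<mu>. w \<alpha> * w \<beta> * (h (vector [y \<alpha>, y \<beta>]) \<bullet> nodal_poly p \<xi> qh (vector [y \<alpha>, y \<beta>])))
      = (\<Sum>s\<in>{0,1}. edge_outflow p \<xi> \<omega> v f F fhat uh up (K, 1, s))"
  proof -
    have "(\<Sum>k\<le>p. ?M i k *\<^sub>R (\<Sum>l\<le>p. ?M j l *\<^sub>R qh k l)) = \<omega> j *\<^sub>R ?rhs 1 i j"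
      if "i \<le> p" "j \<le> p" for i j
    proof -
      have "(\<Sum>l\<le>p. ?M j l *\<^sub>R qh k l) = \<omega> j *\<^sub>R q k j" if "k \<le> p" for k
        using proj[OF \<open>j \<le> p\<close>, of "q k"] qh[OF that] by simp
      then have "(\<Sum>k\<le>p. ?M i k *\<^sub>R (\<Sum>l\<le>p. ?M j l *\<^sub>R qh k l)) = \<omega> j *\<^sub>R (\<Sum>k\<le>p. ?M i k *\<^sub>R q k j)"
        by (simp add: scaleR_sum_right mult.commute)
      then show ?thesis using q[OF that] by simp
    qed
    then have "(\<Sum>\<alpha><\<mu>. \<Sum>\<beta><\<mu>. w \<alpha> * w \<beta> * (h (vector [y \<alpha>, y \<beta>]) \<bullet> nodal_poly p \<xi> qh (vector [y \<alpha>, y \<beta>])))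
        = (\<Sum>j\<le>p. \<omega> j * (\<Sum>i\<le>p. h (line_pt 1 (\<xi> i) (\<xi> j)) \<bullet> ?rhs 1 i j))"
      by (simp add: quadrature_tensor_mass_matrix[OF h inj] line_pt_vector sum_distrib_left)
    then show ?thesis unfolding line .
  qed
  have rpart: "(\<Sum>\<alpha><\<mu>. \<Sum>\<beta><\<mu>. w \<alpha> * w \<beta> * (h (vector [y \<alpha>, y \<beta>]) \<bullet> nodal_poly p \<xi> rh (vector [y \<alpha>, y \<beta>])))
      = (\<Sum>s\<in>{0,1}. edge_outflow p \<xi> \<omega> v f F fhat uh up (K, 2, s))"
  proof -
    have "(\<Sum>k\<le>p. ?M i k *\<^sub>R (\<Sum>l\<le>p. ?M j l *\<^sub>R rh k l)) = \<omega> i *\<^sub>R ?rhs 2 j i"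
      if "i \<le> p" "j \<le> p" for i j
    proof -
      have "(\<Sum>k\<le>p. ?M i k *\<^sub>R rh k l) = \<omega> i *\<^sub>R r i l" if "l \<le> p" for l
        using proj[OF \<open>i \<le> p\<close>, of "\<lambda>k. r k l"] rh[OF _ that] by simp
      moreover have "(\<Sum>k\<le>p. ?M i k *\<^sub>R (\<Sum>l\<le>p. ?M j l *\<^sub>R rh k l))
          = (\<Sum>l\<le>p. ?M j l *\<^sub>R (\<Sum>k\<le>p. ?M i k *\<^sub>R rh k l))"
        unfolding scaleR_sum_right scaleR_left_commute[of "?M i _"] by (rule sum.swap)
      ultimately have "(\<Sum>k\<le>p. ?M i k *\<^sub>R (\<Sum>l\<le>p. ?M j l *\<^sub>R rh k l)) = \<omega> i *\<^sub>R (\<Sum>l\<le>p. ?M j l *\<^sub>R r i l)"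
        by (simp add: scaleR_sum_right mult.commute)
      then show ?thesis using r[OF that] by simp
    qed
    then have "(\<Sum>\<alpha><\<mu>. \<Sum>\<beta><\<mu>. w \<alpha> * w \<beta> * (h (vector [y \<alpha>, y \<beta>]) \<bullet> nodal_poly p \<xi> rh (vector [y \<alpha>, y \<beta>])))
        = (\<Sum>j\<le>p. \<Sum>i\<le>p. \<omega> i * (h (line_pt 2 (\<xi> j) (\<xi> i)) \<bullet> ?rhs 2 j i))"
      by (simp add: quadrature_tensor_mass_matrix[OF h inj] line_pt_vector)
    also have "\<dots> = (\<Sum>i\<le>p. \<omega> i * (\<Sum>j\<le>p. h (line_pt 2 (\<xi> j) (\<xi> i)) \<bullet> ?rhs 2 j i))"
      by (subst sum.swap) (simp add: sum_distrib_left)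
    finally show ?thesis unfolding line .
  qed
  have "(\<Sum>\<alpha><\<mu>. \<Sum>\<beta><\<mu>. w \<alpha> * w \<beta> * (h (vector [y \<alpha>, y \<beta>]) \<bullet>
        nodal_poly p \<xi> (\<lambda>i j. qh i j + rh i j) (vector [y \<alpha>, y \<beta>])))
    = (\<Sum>\<alpha><\<mu>. \<Sum>\<beta><\<mu>. w \<alpha> * w \<beta> * (h (vector [y \<alpha>, y \<beta>]) \<bullet> nodal_poly p \<xi> qh (vector [y \<alpha>, y \<beta>])))
    + (\<Sum>\<alpha><\<mu>. \<Sum>\<beta><\<mu>. w \<alpha> * w \<beta> * (h (vector [y \<alpha>, y \<beta>]) \<bullet> nodal_poly p \<xi> rh (vector [y \<alpha>, y \<beta>])))"
    by (simp add: nodal_poly_add inner_add_right distrib_left sum.distrib)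
  then show ?thesis unfolding qpart rpart sum_2 .
qed

section \<open>The time derivative of the total entropy\<close>

lemma nodal_poly_has_vector_derivative:
  assumes "\<And>i j. i \<le> p \<Longrightarrow> j \<le> p \<Longrightarrow> (a i j has_vector_derivative a' i j) F"
  shows "((\<lambda>t. nodal_poly p \<xi> (\<lambda>i j. a i j t) x) has_vector_derivative nodal_poly p \<xi> a' x) F"
  unfolding nodal_poly_def
  by (intro has_vector_derivative_sum
      bounded_linear.has_vector_derivative[OF bounded_linear_scaleR_right] assms) auto

lemma has_real_derivative_gradient_chain:
  fixes u :: "real \<Rightarrow> 'a :: real_inner"
  assumes "(u has_vector_derivative u') (at t within I)" "GDERIV U (u t) :> g"
  shows "((\<lambda>t. U (u t)) has_real_derivative g \<bullet> u') (at t within I)"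
proof -
  have "((\<lambda>t. U (u t)) has_derivative (\<lambda>x. (x *\<^sub>R u') \<bullet> g)) (at t within I)"
    using assms unfolding has_vector_derivative_def gderiv_def by (rule has_derivative_compose)
  then show ?thesis
    unfolding has_field_derivative_def
    by (rule has_derivative_eq_rhs) (simp add: fun_eq_iff inner_commute mult.commute)
qed

theorem proposition5:
  fixes p \<mu> :: nat
    and \<xi> \<omega> y w :: "nat \<Rightarrow> real"
    and D :: "(real^'c) set"
    and U :: "real^'c \<Rightarrow> real" and v :: "real^'c \<Rightarrow> real^'c"
    and f :: "2 \<Rightarrow> real^'c \<Rightarrow> real^'c" and F :: "2 \<Rightarrow> real^'c \<Rightarrow> real"
    and fS :: "2 \<Rightarrow> real^'c \<Rightarrow> real^'c \<Rightarrow> real^'c"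
    and fhat :: "real^'c \<Rightarrow> real^'c \<Rightarrow> real^2 \<Rightarrow> real^'c"
    and \<Omega> :: "(real^2) set" and \<T> :: "elem set" and I :: "real set"
    and ut :: "elem \<Rightarrow> nat \<Rightarrow> nat \<Rightarrow> real \<Rightarrow> real^'c"
    and vh uh :: "elem \<Rightarrow> real \<Rightarrow> real^2 \<Rightarrow> real^'c"
    and up :: "real \<Rightarrow> elem_edge \<Rightarrow> real^2 \<Rightarrow> real^'c"
    and u :: "elem \<Rightarrow> real \<Rightarrow> real^2 \<Rightarrow> real^'c"
    and q r qh rh :: "elem \<Rightarrow> real \<Rightarrow> nat \<Rightarrow> nat \<Rightarrow> real^'c"
  assumes "1 \<le> p" and "p + 1 \<le> \<mu>"
    and "gauss_lobatto (p + 1) \<xi> \<omega>" and "gauss_lobatto \<mu> y w"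
    and "entropy_system D U v f F"
    and "entropy_conservative_flux D v f F fS"
    and "entropy_stable_flux D v f F fhat"
    and "conforming_mesh \<Omega> \<T>"
    and "is_interval I"
    and u: "\<And>K t x. u K t x = (1 / jdet K) *\<^sub>R nodal_poly p \<xi> (\<lambda>i j. ut K i j t) x"
    and "\<And>K t \<alpha> \<beta>. K \<in> \<T> \<Longrightarrow> t \<in> I \<Longrightarrow> \<alpha> < \<mu> \<Longrightarrow> \<beta> < \<mu> \<Longrightarrow>
           u K t (vector [y \<alpha>, y \<beta>]) \<in> D"
    and vh: "\<And>K t. K \<in> \<T> \<Longrightarrow> t \<in> I \<Longrightarrow>
           is_quadrature_projection p \<mu> y w (\<lambda>x. v (u K t x)) (vh K t)"
    and "\<And>K t d \<alpha> j. K \<in> \<T> \<Longrightarrow> t \<in> I \<Longrightarrow> \<alpha> < \<mu> \<Longrightarrow> j \<le> p \<Longrightarrow>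
           vh K t (line_pt d (y \<alpha>) (\<xi> j)) \<in> v ` D"
    and uh: "\<And>K t x. uh K t x = the_inv_into D v (vh K t x)"
    and "\<And>t. t \<in> I \<Longrightarrow> neighbor_traces \<T> (\<lambda>K. uh K t) (up t)"
    and bc: "(\<exists>per \<tau>. periodic_identification \<Omega> \<T> per \<tau> \<and>
                (\<forall>t\<in>I. periodic_traces \<Omega> \<T> per \<tau> (\<lambda>K. uh K t) (up t))) \<or>
             (\<forall>t\<in>I. boundary_contribution p \<xi> \<omega> v f F fhat \<Omega> \<T> (\<lambda>K. uh K t) (up t) = 0)"
    and q: "\<And>K t i j. K \<in> \<T> \<Longrightarrow> t \<in> I \<Longrightarrow> i \<le> p \<Longrightarrow> j \<le> p \<Longrightarrow>
           (\<Sum>k\<le>p. mass_matrix p \<mu> \<xi> y w i k *\<^sub>R q K t k j) =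
           line_rhs p \<mu> \<xi> y w f fS fhat K (uh K t) (up t) 1 i j"
    and r: "\<And>K t i j. K \<in> \<T> \<Longrightarrow> t \<in> I \<Longrightarrow> i \<le> p \<Longrightarrow> j \<le> p \<Longrightarrow>
           (\<Sum>k\<le>p. mass_matrix p \<mu> \<xi> y w j k *\<^sub>R r K t i k) =
           line_rhs p \<mu> \<xi> y w f fS fhat K (uh K t) (up t) 2 j i"
    and qh: "\<And>K t i j. K \<in> \<T> \<Longrightarrow> t \<in> I \<Longrightarrow> i \<le> p \<Longrightarrow> j \<le> p \<Longrightarrow>
           qh K t i j = (\<Sum>k\<le>p. node_projection p \<mu> \<xi> \<omega> y w j k *\<^sub>R q K t i k)"
    and rh: "\<And>K t i j. K \<in> \<T> \<Longrightarrow> t \<in> I \<Longrightarrow> i \<le> p \<Longrightarrow> j \<le> p \<Longrightarrow>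
           rh K t i j = (\<Sum>k\<le>p. node_projection p \<mu> \<xi> \<omega> y w i k *\<^sub>R r K t k j)"
    and scheme: "\<And>K t i j. K \<in> \<T> \<Longrightarrow> t \<in> I \<Longrightarrow> i \<le> p \<Longrightarrow> j \<le> p \<Longrightarrow>
           (ut K i j has_vector_derivative - (qh K t i j + rh K t i j)) (at t within I)"
  shows "\<forall>t\<in>I. \<exists>E'. ((\<lambda>t. \<Sum>K\<in>\<T>. \<Sum>\<alpha><\<mu>. \<Sum>\<beta><\<mu>.
                      w \<alpha> * w \<beta> * jdet K * U (u K t (vector [y \<alpha>, y \<beta>])))
                    has_real_derivative E') (at t within I) \<and> E' \<le> 0"
proof (rule ballI)
  fix t assume t: "t \<in> I"
  note gl = assms(3,4) and mesh = assms(8)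
  note uD = assms(11) and vhD = assms(13)
  have inj: "inj_on v D" and grad: "\<And>z. z \<in> D \<Longrightarrow> GDERIV U z :> v z"
    using assms(5) unfolding entropy_system_def by auto
  have det: "jdet K > 0" if "K \<in> \<T>" for K
    using mesh that unfolding conforming_mesh_def by blast
  define G where "G = (\<lambda>K. nodal_poly p \<xi> (\<lambda>i j. qh K t i j + rh K t i j))"
  define S where "S = (\<lambda>K. \<Sum>\<alpha><\<mu>. \<Sum>\<beta><\<mu>. w \<alpha> * w \<beta> *
    (vh K t (vector [y \<alpha>, y \<beta>]) \<bullet> G K (vector [y \<alpha>, y \<beta>])))"
  have uhD: "uh K t (line_pt d (y \<alpha>) (\<xi> j)) \<in> D"
    and vuh: "v (uh K t (line_pt d (y \<alpha>) (\<xi> j))) = vh K t (line_pt d (y \<alpha>) (\<xi> j))"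
    if "K \<in> \<T>" "\<alpha> < \<mu>" "j \<le> p" for K d \<alpha> j
    using vhD[OF that(1) t that(2,3)] inj unfolding uh
    by (auto simp: f_the_inv_into_f intro: the_inv_into_into)
  \<comment> \<open>The faces are covered because the end points are Gauss--Lobatto points.\<close>
  have faceD: "uh K t (line_pt d s (\<xi> k)) \<in> D" if "K \<in> \<T>" "s \<in> {0, 1}" "k \<le> p" for K d s k
    using uhD[OF that(1) _ that(3), of 0] uhD[OF that(1) _ that(3), of "\<mu> - 1"]
      gauss_lobattoD(1,3,4)[OF gl(2)] that(2) by auto
  have "((\<lambda>t. \<Sum>K\<in>\<T>. \<Sum>\<alpha><\<mu>. \<Sum>\<beta><\<mu>. w \<alpha> * w \<beta> * jdet K * U (u K t (vector [y \<alpha>, y \<beta>])))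
      has_real_derivative
        (\<Sum>K\<in>\<T>. \<Sum>\<alpha><\<mu>. \<Sum>\<beta><\<mu>. w \<alpha> * w \<beta> * jdet K * (v (u K t (vector [y \<alpha>, y \<beta>])) \<bullet>
          ((1 / jdet K) *\<^sub>R - G K (vector [y \<alpha>, y \<beta>]))))) (at t within I)"
  proof (intro DERIV_sum DERIV_cmult has_real_derivative_gradient_chain)
    fix K \<alpha> \<beta> assume K: "K \<in> \<T>" and "\<alpha> \<in> {..<\<mu>}" "\<beta> \<in> {..<\<mu>}"
    then show "GDERIV U (u K t (vector [y \<alpha>, y \<beta>])) :> v (u K t (vector [y \<alpha>, y \<beta>]))"
      using uD[OF K t] by (intro grad) auto
    have neg: "nodal_poly p \<xi> (\<lambda>i j. - (qh K t i j + rh K t i j)) x = - G K x" for x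
      unfolding G_def nodal_poly_def by (simp only: scaleR_minus_right sum_negf)
    then have "((\<lambda>t. nodal_poly p \<xi> (\<lambda>i j. ut K i j t) x) has_vector_derivative - G K x)
        (at t within I)" for x
      unfolding neg[symmetric] by (intro nodal_poly_has_vector_derivative scheme[OF K t])
    then show "((\<lambda>t. u K t (vector [y \<alpha>, y \<beta>])) has_vector_derivative
        (1 / jdet K) *\<^sub>R - G K (vector [y \<alpha>, y \<beta>])) (at t within I)"
      unfolding u by (intro bounded_linear.has_vector_derivative[OF bounded_linear_scaleR_right])
  qed
  also have "(\<Sum>K\<in>\<T>. \<Sum>\<alpha><\<mu>. \<Sum>\<beta><\<mu>. w \<alpha> * w \<beta> * jdet K * (v (u K t (vector [y \<alpha>, y \<beta>])) \<bullet>
          ((1 / jdet K) *\<^sub>R - G K (vector [y \<alpha>, y \<beta>])))) = - (\<Sum>K\<in>\<T>. S K)"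
  proof -
    have "(\<Sum>\<alpha><\<mu>. \<Sum>\<beta><\<mu>. w \<alpha> * w \<beta> * jdet K * (v (u K t (vector [y \<alpha>, y \<beta>])) \<bullet>
          ((1 / jdet K) *\<^sub>R - G K (vector [y \<alpha>, y \<beta>])))) = - S K" if K: "K \<in> \<T>" for K
    proof -
      \<comment> \<open>The time derivative is an admissible test function in the definition of the projection.\<close>
      have "G K \<in> tensor_polys p" unfolding G_def by (rule nodal_poly_in_tensor_polys)
      then have "S K = (\<Sum>\<alpha><\<mu>. \<Sum>\<beta><\<mu>. w \<alpha> * w \<beta> *
          (v (u K t (vector [y \<alpha>, y \<beta>])) \<bullet> G K (vector [y \<alpha>, y \<beta>])))"
        using vh[OF K t] unfolding is_quadrature_projection_def S_def by blast
      then show ?thesis using det[OF K] by (simp add: sum_negf mult.assoc)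
    qed
    then show ?thesis by (simp add: sum_negf)
  qed
  finally have deriv: "((\<lambda>t. \<Sum>K\<in>\<T>. \<Sum>\<alpha><\<mu>. \<Sum>\<beta><\<mu>.
      w \<alpha> * w \<beta> * jdet K * U (u K t (vector [y \<alpha>, y \<beta>])))
    has_real_derivative - (\<Sum>K\<in>\<T>. S K)) (at t within I)" .
  let ?B = "edge_outflow p \<xi> \<omega> v f F fhat (\<lambda>K. uh K t) (up t)"
  have "S K = (\<Sum>d\<in>UNIV. \<Sum>s\<in>{0,1}. ?B (K, d, s))" if K: "K \<in> \<T>" for K
    unfolding S_def G_def
  proof (rule element_entropy_identity[OF gl assms(2,6), where q = "q K t" and r = "r K t"])
    show "vh K t \<in> tensor_polys p"
      using vh[OF K t] unfolding is_quadrature_projection_def by blast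
  qed (use uhD[OF K] vuh[OF K] q[OF K t] r[OF K t] qh[OF K t] rh[OF K t] in auto)
  then have "(\<Sum>K\<in>\<T>. S K) = (\<Sum>K\<in>\<T>. \<Sum>d\<in>UNIV. \<Sum>s\<in>{0,1}. ?B (K, d, s))" by simp
  also have "\<dots> = (\<Sum>e\<in>elem_edges \<T>. ?B e)"
    unfolding elem_edges_def by (simp only: sum.cartesian_product split_def prod.collapse)
  finally have "(\<Sum>K\<in>\<T>. S K) = (\<Sum>e\<in>elem_edges \<T>. ?B e)" .
  moreover have "0 \<le> (\<Sum>e\<in>elem_edges \<T>. ?B e)"
    using bc t by (intro total_outflow_nonneg[OF gl(1) assms(7) mesh faceD assms(15)[OF t]]) auto
  ultimately show "\<exists>E'. ((\<lambda>t. \<Sum>K\<in>\<T>. \<Sum>\<alpha><\<mu>. \<Sum>\<beta><\<mu>.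
      w \<alpha> * w \<beta> * jdet K * U (u K t (vector [y \<alpha>, y \<beta>])))
    has_real_derivative E') (at t within I) \<and> E' \<le> 0"
    using deriv by (intro exI[of _ "- (\<Sum>K\<in>\<T>. S K)"]) auto
qed

end
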